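(* There is a linear-time algorithm that, given an instance $(F,A,B)$ of Formula-Pair with a formula of size $s$ and lists of size $n$, computes a text $t$ and a regular expression $p$ over the alphabet $\{0,1\}$, with text length and pattern size $O(n\cdot s\log s)$, such that $p$ matches some substring of $t$ if and only if there exist $a\in A,b\in B$ with $F(a,b)=\mathsf{true}$.
   Context: Formula-Pair: given a deMorgan formula $F(x_1,\dots,x_m,y_1,\dots,y_m)$ in which each variable appears exactly once, and $A,B\subseteq\{0,1\}^m$ of size $n$, decide whether some $a\in A,b\in B$ satisfy $F(a_1,\dots,a_m,b_1,\dots,b_m)=\mathsf{true}$. Regular expressions are built from single symbols, concatenation, union ($|$) and Kleene star ($^*$) with the usual semantics; the pattern size is the length of the expression. *)

theory Defs
  imports Complex_Main "HOL-Library.Sublist"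
begin

section \<open>Formula-Pair\<close>

text \<open>Vectors in \<open>{0,1}^m\<close> are Boolean lists of length \<open>m\<close>; \<open>X i\<close> and \<open>Y i\<close> for \<open>i < m\<close>
  are the variables written \<open>x_(i+1)\<close> and \<open>y_(i+1)\<close>.\<close>

datatype var = X nat | Y nat

datatype formula = Var var | Not formula | And formula formula | Or formula formula

fun holds :: "formula \<Rightarrow> bool list \<Rightarrow> bool list \<Rightarrow> bool" where
  "holds (Var (X i)) a b \<longleftrightarrow> a ! i"
| "holds (Var (Y i)) a b \<longleftrightarrow> b ! i"
| "holds (Not F) a b \<longleftrightarrow> \<not> holds F a b"
| "holds (And F G) a b \<longleftrightarrow> holds F a b \<and> holds G a b"
| "holds (Or F G) a b \<longleftrightarrow> holds F a b \<or> holds G a b"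

fun leaves :: "formula \<Rightarrow> var list" where
  "leaves (Var v) = [v]"
| "leaves (Not F) = leaves F"
| "leaves (And F G) = leaves F @ leaves G"
| "leaves (Or F G) = leaves F @ leaves G"

text \<open>As usual for deMorgan formulas, the size is the number of leaves.\<close>

definition formula_size :: "formula \<Rightarrow> nat" where
  "formula_size F = length (leaves F)"

definition each_variable_once :: "nat \<Rightarrow> formula \<Rightarrow> bool" where
  "each_variable_once m F \<longleftrightarrow>
     distinct (leaves F) \<and> set (leaves F) = X ` {..<m} \<union> Y ` {..<m}"

text \<open>The sets \<open>A, B \<subseteq> {0,1}^m\<close> are presented to the algorithm as lists without repetition.\<close>

definition enumerates_vectors :: "nat \<Rightarrow> nat \<Rightarrow> bool list list \<Rightarrow> bool" where
  "enumerates_vectors m n A \<longleftrightarrow> distinct A \<and> length A = n \<and> (\<forall>a \<in> set A. length a = m)"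

definition formula_pair_instance ::
    "nat \<Rightarrow> nat \<Rightarrow> formula \<Rightarrow> bool list list \<Rightarrow> bool list list \<Rightarrow> bool" where
  "formula_pair_instance m n F A B \<longleftrightarrow>
     each_variable_once m F \<and> enumerates_vectors m n A \<and> enumerates_vectors m n B"


section \<open>Regular expressions\<close>

datatype 'a rexp = Sym 'a | Concat "'a rexp" "'a rexp" | Union "'a rexp" "'a rexp" | Star "'a rexp"

fun lang :: "'a rexp \<Rightarrow> 'a list set" where
  "lang (Sym c) = {[c]}"
| "lang (Concat r s) = {u @ v |u v. u \<in> lang r \<and> v \<in> lang s}"
| "lang (Union r s) = lang r \<union> lang s"
| "lang (Star r) = {concat ws |ws. set ws \<subseteq> lang r}"

text \<open>Length of the expression as a string, parentheses included, in the notation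
  \<open>c\<close>, \<open>rs\<close>, \<open>(r|s)\<close>, \<open>(r)*\<close>.\<close>

fun rexp_length :: "'a rexp \<Rightarrow> nat" where
  "rexp_length (Sym c) = 1"
| "rexp_length (Concat r s) = rexp_length r + rexp_length s"
| "rexp_length (Union r s) = rexp_length r + rexp_length s + 3"
| "rexp_length (Star r) = rexp_length r + 3"

definition matches_substring :: "'a rexp \<Rightarrow> 'a list \<Rightarrow> bool" where
  "matches_substring p t \<longleftrightarrow> (\<exists>u \<in> lang p. sublist u t)"


section \<open>Algorithms and running time\<close>

text \<open>An algorithm is a program of a first-order call-by-value functional language on binary trees
  (cons cells), in the style of pure Lisp. Every evaluated expression node costs one unit, whatever
  the size of the values involved. For a fixed program each such unit takes constant time on a
  pointer machine or a word RAM (values are passed by reference), so a time bound in this model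
  yields the same bound there up to a constant factor. There is no built-in arithmetic and no
  random access. The library function \<open>size\<close> on trees counts the cons cells.\<close>

datatype tree = Leaf | Node tree tree

text \<open>Variables are de Bruijn indices into the environment; \<open>ECase\<close> binds the two children and
  \<open>ELet\<close> binds one value.
  A program is the list of its function bodies; a body is evaluated with the argument values as
  environment, and the entry point is function \<open>0\<close>, applied to the input.\<close>

datatype expr =
    EVar nat
  | ELeaf
  | ENode expr expr
  | ECase expr expr expr
  | ELet expr expr
  | ECall nat "expr list"

type_synonym program = "expr list"

inductive big_step :: "program \<Rightarrow> tree list \<Rightarrow> expr \<Rightarrow> tree \<Rightarrow> nat \<Rightarrow> bool"
  and big_steps :: "program \<Rightarrow> tree list \<Rightarrow> expr list \<Rightarrow> tree list \<Rightarrow> nat \<Rightarrow> bool"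
  for P :: program
where
  BVar: "i < length env \<Longrightarrow> big_step P env (EVar i) (env ! i) 1"
| BLeaf: "big_step P env ELeaf Leaf 1"
| BNode: "\<lbrakk>big_step P env e1 v1 k1; big_step P env e2 v2 k2\<rbrakk>
    \<Longrightarrow> big_step P env (ENode e1 e2) (Node v1 v2) (k1 + k2 + 1)"
| BCase_Leaf: "\<lbrakk>big_step P env e Leaf k; big_step P env e1 v k1\<rbrakk>
    \<Longrightarrow> big_step P env (ECase e e1 e2) v (k + k1 + 1)"
| BCase_Node: "\<lbrakk>big_step P env e (Node l r) k; big_step P (l # r # env) e2 v k2\<rbrakk>
    \<Longrightarrow> big_step P env (ECase e e1 e2) v (k + k2 + 1)"
| BLet: "\<lbrakk>big_step P env e1 v1 k1; big_step P (v1 # env) e2 v k2\<rbrakk>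
    \<Longrightarrow> big_step P env (ELet e1 e2) v (k1 + k2 + 1)"
| BCall: "\<lbrakk>big_steps P env es vs k; f < length P; big_step P vs (P ! f) v k'\<rbrakk>
    \<Longrightarrow> big_step P env (ECall f es) v (k + k' + 1)"
| BNil: "big_steps P env [] [] 0"
| BCons: "\<lbrakk>big_step P env e v k; big_steps P env es vs k'\<rbrakk>
    \<Longrightarrow> big_steps P env (e # es) (v # vs) (k + k')"

definition computes_in_time :: "program \<Rightarrow> tree \<Rightarrow> tree \<Rightarrow> nat \<Rightarrow> bool" where
  "computes_in_time P inp out k \<longleftrightarrow> P \<noteq> [] \<and> big_step P [inp] (P ! 0) out k"

inductive_cases big_step_elims:
  "big_step P env (EVar i) v k"
  "big_step P env ELeaf v k"
  "big_step P env (ENode e1 e2) v k"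
  "big_step P env (ECase e e1 e2) v k"
  "big_step P env (ELet e1 e2) v k"
  "big_step P env (ECall f es) v k"
  "big_steps P env [] vs k"
  "big_steps P env (e # es) vs k"

lemma big_step_deterministic:
  "big_step P env e v k \<Longrightarrow> big_step P env e v' k' \<Longrightarrow> v = v' \<and> k = k'"
  "big_steps P env es vs k \<Longrightarrow> big_steps P env es vs' k' \<Longrightarrow> vs = vs' \<and> k = k'"
proof (induction arbitrary: v' k' and vs' k' rule: big_step_big_steps.inducts)
  case (BVar i env)
  then show ?case by (auto elim: big_step_elims)
next
  case (BLeaf env)
  then show ?case by (auto elim: big_step_elims)
next
  case (BNode env e1 v1 k1 e2 v2 k2)
  from BNode.prems show ?case
    by (rule big_step_elims(3)) (metis Suc_eq_plus1 BNode.IH)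
next
  case (BCase_Leaf env e k e1 v k1 e2)
  from BCase_Leaf.prems show ?case
    by (rule big_step_elims(4)) (metis Suc_eq_plus1 BCase_Leaf.IH tree.distinct(1) tree.inject)+
next
  case (BCase_Node env e l r k e2 v k2 e1)
  from BCase_Node.prems show ?case
    by (rule big_step_elims(4)) (metis Suc_eq_plus1 BCase_Node.IH tree.distinct(1) tree.inject)+
next
  case (BLet env e1 v1 k1 e2 v k2)
  from BLet.prems show ?case
    by (rule big_step_elims(5)) (metis Suc_eq_plus1 BLet.IH)
next
  case (BCall env es vs k f v l)
  from BCall.prems show ?case
    by (rule big_step_elims(6)) (metis Suc_eq_plus1 BCall.IH)
next
  case (BNil env)
  then show ?case by (auto elim: big_step_elims)
next
  case (BCons env e v k es vs l)
  from BCons.prems show ?case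
    by (rule big_step_elims(8)) (metis Suc_eq_plus1 BCons.IH)
qed


section \<open>Encoding of inputs and outputs\<close>

fun enc_bool :: "bool \<Rightarrow> tree" where
  "enc_bool False = Leaf"
| "enc_bool True = Node Leaf Leaf"

text \<open>Binary, least significant bit first.\<close>

fun enc_nat :: "nat \<Rightarrow> tree" where
  "enc_nat n = (if n = 0 then Leaf else Node (enc_bool (odd n)) (enc_nat (n div 2)))"

declare enc_nat.simps [simp del]

fun enc_list :: "('a \<Rightarrow> tree) \<Rightarrow> 'a list \<Rightarrow> tree" where
  "enc_list enc [] = Leaf"
| "enc_list enc (x # xs) = Node (enc x) (enc_list enc xs)"

fun enc_var :: "var \<Rightarrow> tree" where
  "enc_var (X i) = Node (enc_bool False) (enc_nat i)"
| "enc_var (Y i) = Node (enc_bool True) (enc_nat i)"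

fun enc_formula :: "formula \<Rightarrow> tree" where
  "enc_formula (Var v) = Node (enc_nat 0) (enc_var v)"
| "enc_formula (Not F) = Node (enc_nat 1) (enc_formula F)"
| "enc_formula (And F G) = Node (enc_nat 2) (Node (enc_formula F) (enc_formula G))"
| "enc_formula (Or F G) = Node (enc_nat 3) (Node (enc_formula F) (enc_formula G))"

fun enc_rexp :: "bool rexp \<Rightarrow> tree" where
  "enc_rexp (Sym c) = Node (enc_nat 0) (enc_bool c)"
| "enc_rexp (Concat r s) = Node (enc_nat 1) (Node (enc_rexp r) (enc_rexp s))"
| "enc_rexp (Union r s) = Node (enc_nat 2) (Node (enc_rexp r) (enc_rexp s))"
| "enc_rexp (Star r) = Node (enc_nat 3) (enc_rexp r)"

definition enc_instance :: "formula \<Rightarrow> bool list list \<Rightarrow> bool list list \<Rightarrow> tree" where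
  "enc_instance F A B =
     Node (enc_formula F) (Node (enc_list (enc_list enc_bool) A) (enc_list (enc_list enc_bool) B))"

definition enc_output :: "bool list \<Rightarrow> bool rexp \<Rightarrow> tree" where
  "enc_output t p = Node (enc_list enc_bool t) (enc_rexp p)"

lemma enc_bool_inject: "enc_bool b = enc_bool c \<longleftrightarrow> b = c"
  by (cases b; cases c) auto

lemma enc_list_inject:
  "(\<And>x y. enc x = enc y \<Longrightarrow> x = y) \<Longrightarrow> enc_list enc xs = enc_list enc ys \<longleftrightarrow> xs = ys"
proof (induction xs arbitrary: ys)
  case Nil
  then show ?case by (cases ys) auto
next
  case (Cons x xs)
  then show ?case by (cases ys) auto
qed

lemma enc_nat_inject: "enc_nat m = enc_nat n \<longleftrightarrow> m = n"
proof (induction m arbitrary: n rule: less_induct)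
  case (less m)
  show ?case
  proof (cases "m = 0 \<or> n = 0")
    case True
    then show ?thesis using enc_nat.simps[of m] enc_nat.simps[of n] by auto
  next
    case False
    have "enc_nat m = Node (enc_bool (odd m)) (enc_nat (m div 2))"
         "enc_nat n = Node (enc_bool (odd n)) (enc_nat (n div 2))"
      using False enc_nat.simps[of m] enc_nat.simps[of n] by auto
    moreover have "enc_nat (m div 2) = enc_nat (n div 2) \<longleftrightarrow> m div 2 = n div 2"
      using False by (intro less) auto
    ultimately have "enc_nat m = enc_nat n \<longleftrightarrow> odd m = odd n \<and> m div 2 = n div 2"
      by (simp only: tree.inject enc_bool_inject)
    also have "\<dots> \<longleftrightarrow> m = n"
      by presburger
    finally show ?thesis .
  qed
qed

lemma enc_rexp_inject: "enc_rexp r = enc_rexp s \<longleftrightarrow> r = s"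
proof (induction r arbitrary: s)
  case (Sym c)
  then show ?case by (cases s) (auto simp: enc_nat_inject enc_bool_inject)
next
  case (Concat r1 r2)
  then show ?case by (cases s) (auto simp: enc_nat_inject)
next
  case (Union r1 r2)
  then show ?case by (cases s) (auto simp: enc_nat_inject)
next
  case (Star r)
  then show ?case by (cases s) (auto simp: enc_nat_inject)
qed

lemma enc_output_inject: "enc_output t p = enc_output t' p' \<longleftrightarrow> t = t' \<and> p = p'"
  using enc_list_inject[of enc_bool] by (auto simp: enc_output_def enc_bool_inject enc_rexp_inject)

end

(* A token is a bit string closed by an end marker; a literal is represented by a token holding the
   name of its variable and one truth value. The text of a vector a lists these tokens in the order
   of the leaves, with the value of x_i under a, and with value true for y_i. The pattern of a
   vector b asks at a leaf for the token carrying the value that satisfies the literal. A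
   conjunction is the concatenation of its parts, a disjunction is p1 ANY* | ANY* p2 with ANY an
   arbitrary token. Names are unique, so a token that the pattern asks for can be found in the text
   only at its own leaf; hence a match yields a satisfied formula no matter where the ANY* stop.
   Names have O(log s) bits, which is the origin of the factor log s.
   Letters are coded as 1^j 0 (bits by j = 0, 1, the end marker by j = 2, the delimiter of the
   blocks by j = 3), and both text blocks and pattern are delimited; since every letter ends with 0,
   a pattern starting with 0 can occur in the text only at a letter boundary.
   Negations are pushed to the leaves once, as the instance may contain many more of them than
   leaves. The entries of a vector are accessed through a Braun tree in time O(number of bits of
   the index), which is paid for by the name of the variable in the output. *)

theory Submission
  imports Defs
begin

section \<open>The program\<close>

lemma enc_nat_num [simp]:
  "enc_nat 0 = Leaf" "enc_nat (Suc 0) = Node (Node Leaf Leaf) Leaf"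
  "enc_nat 2 = Node Leaf (Node (Node Leaf Leaf) Leaf)"
  "enc_nat 3 = Node (Node Leaf Leaf) (Node (Node Leaf Leaf) Leaf)"
  by (simp_all add: enc_nat.simps)

fun quote :: "tree \<Rightarrow> expr" where
  "quote Leaf = ELeaf"
| "quote (Node l r) = ENode (quote l) (quote r)"

text \<open>Stated as equations, the evaluation rules let the simplifier compute the value and the
  exact cost of an expression in one pass.\<close>

lemma big_step_iffs:
  "big_step P env (EVar i) v k \<longleftrightarrow> i < length env \<and> v = env ! i \<and> k = 1"
  "big_step P env ELeaf v k \<longleftrightarrow> v = Leaf \<and> k = 1"
  "big_step P env (ENode e1 e2) v k \<longleftrightarrow> (\<exists>v1 k1 v2 k2. big_step P env e1 v1 k1 \<and>
     big_step P env e2 v2 k2 \<and> v = Node v1 v2 \<and> k = k1 + k2 + 1)"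
  "big_step P env (ECase e e1 e2) v k \<longleftrightarrow>
     (\<exists>k0 k1. big_step P env e Leaf k0 \<and> big_step P env e1 v k1 \<and> k = k0 + k1 + 1) \<or>
     (\<exists>l r k0 k1. big_step P env e (Node l r) k0 \<and> big_step P (l # r # env) e2 v k1 \<and>
        k = k0 + k1 + 1)"
  "big_step P env (ELet e1 e2) v k \<longleftrightarrow>
     (\<exists>v1 k1 k2. big_step P env e1 v1 k1 \<and> big_step P (v1 # env) e2 v k2 \<and> k = k1 + k2 + 1)"
  "big_step P env (ECall f es) v k \<longleftrightarrow>
     (\<exists>vs k1 k2. big_steps P env es vs k1 \<and> f < length P \<and> big_step P vs (P ! f) v k2 \<and>
        k = k1 + k2 + 1)"
  by - (subst big_step.simps, (simp; fail | auto; fail | simp, blast))+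

lemma big_steps_iffs:
  "big_steps P env [] vs k \<longleftrightarrow> vs = [] \<and> k = 0"
  "big_steps P env (e # es) vs k \<longleftrightarrow> (\<exists>w k1 ws k2. big_step P env e w k1 \<and>
     big_steps P env es ws k2 \<and> vs = w # ws \<and> k = k1 + k2)"
  by - (subst big_steps.simps, (simp; fail | simp, blast))+

lemma big_step_quote: "big_step P env (quote t) v k \<longleftrightarrow> v = t \<and> k = 2 * size t + 1"
  by (induction t arbitrary: v k) (auto simp: big_step_iffs)

definition tok_end :: "bool rexp" where
  "tok_end = Concat (Sym True) (Concat (Sym True) (Sym False))"

definition any_bit :: "bool rexp" where
  "any_bit = Union (Sym False) (Concat (Sym True) (Sym False))"

text \<open>This is ANY*. Its words consist of complete tokens, which keeps the rest of a pattern
  aligned with token boundaries.\<close>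

definition any_toks :: "bool rexp" where
  "any_toks = Star (Concat (Star any_bit) tok_end)"

definition delim :: "bool rexp" where
  "delim = Concat (Sym True) (Concat (Sym True) (Concat (Sym True) (Sym False)))"

abbreviation eTrue :: expr where "eTrue \<equiv> ENode ELeaf ELeaf"
abbreviation eNot :: "expr \<Rightarrow> expr" where "eNot e \<equiv> ECase e eTrue ELeaf"
abbreviation eConcat :: "expr \<Rightarrow> expr \<Rightarrow> expr" where
  "eConcat r s \<equiv> ENode (quote (enc_nat 1)) (ENode r s)"
abbreviation eUnion :: "expr \<Rightarrow> expr \<Rightarrow> expr" where
  "eUnion r s \<equiv> ENode (quote (enc_nat 2)) (ENode r s)"
abbreviation eRexp :: "bool rexp \<Rightarrow> expr" where
  "eRexp r \<equiv> quote (enc_rexp r)"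

text \<open>\<^term>\<open>ECall i\<close> calls the function in position \<open>i\<close> of the list \<open>prog\<close> below. Each function is
  specified by a HOL function on trees, with the same arguments in the same order, and by a function
  giving its exact running time.\<close>

definition main_body :: expr where
  "main_body =
   ECase (EVar 0) ELeaf (ECase (EVar 1) ELeaf
     (ELet (ECall 10 [EVar 2, ELeaf])
       (ENode
         (ENode ELeaf (ENode eTrue (ENode eTrue (ENode eTrue (ENode ELeaf
            (ECall 6 [EVar 1, ECall 11 [EVar 3, ELeaf]]))))))
         (eConcat (eRexp (Sym False)) (eConcat (eRexp delim)
            (eConcat (ECall 9 [EVar 2, EVar 0]) (eRexp delim)))))))"

definition trie_cons_body :: expr where
  "trie_cons_body =
   ECase (EVar 1) (ENode (EVar 0) (ENode ELeaf ELeaf))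
     (ECase (EVar 1) ELeaf (ENode (EVar 4) (ENode (ECall 1 [EVar 2, EVar 1]) (EVar 0))))"

definition trie_of_body :: expr where
  "trie_of_body =
   ECase (EVar 0) ELeaf (ECall 1 [EVar 0, ECall 2 [EVar 1]])"

definition look_body :: expr where
  "look_body =
   ECase (EVar 2) (EVar 0) (ECase (EVar 3) (EVar 2) (ECase (EVar 1) (EVar 4)
     (ECase (EVar 4) (ECall 3 [EVar 6, EVar 0, EVar 5]) (ECall 3 [EVar 4, EVar 3, EVar 7]))))"

definition emit_body :: expr where
  "emit_body =
   ECase (EVar 0) (ENode eTrue (ENode eTrue (ENode ELeaf (EVar 1))))
     (ECase (EVar 0)
        (ENode ELeaf (ECall 4 [EVar 1, EVar 3]))
        (ENode eTrue (ENode ELeaf (ECall 4 [EVar 3, EVar 5]))))"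

definition text_body :: expr where
  "text_body =
   ECase (EVar 0) (EVar 3) (ECase (EVar 0) ELeaf
     (ECall 4 [ENode (ECase (EVar 0) (ECall 3 [EVar 5, EVar 6, EVar 1]) eTrue) (EVar 2),
       ECall 5 [EVar 3, EVar 5, EVar 6, EVar 7]]))"

definition texts_body :: expr where
  "texts_body =
   ECase (EVar 0) ELeaf (ECase (EVar 0) ELeaf
     (ECall 5 [EVar 5, EVar 0, ECall 2 [EVar 1],
       ENode eTrue (ENode eTrue (ENode eTrue (ENode ELeaf (ECall 6 [EVar 3, EVar 5]))))]))"

definition tok_body :: expr where
  "tok_body =
   ECase (EVar 0) (eRexp tok_end) (ECase (EVar 0)
     (eConcat (eRexp (Sym False)) (ECall 7 [EVar 1]))
     (eConcat (eRexp (Sym True)) (eConcat (eRexp (Sym False)) (ECall 7 [EVar 3]))))"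

definition pat_body :: expr where
  "pat_body =
   ECase (EVar 0) ELeaf (ECase (EVar 0)
     (ECase (EVar 1) ELeaf (ECase (EVar 1) ELeaf
       (ECall 7 [ENode
          (ECase (EVar 0) (eNot (EVar 2))
             (ECase (ECall 3 [EVar 9, EVar 10, EVar 3]) (EVar 4) (eNot (EVar 6))))
          (EVar 3)])))
     (ECase (EVar 3) ELeaf
       (ECase (EVar 2)
         (eConcat (ECall 8 [EVar 0, EVar 7, EVar 8]) (ECall 8 [EVar 1, EVar 7, EVar 8]))
         (eUnion (eConcat (ECall 8 [EVar 2, EVar 9, EVar 10]) (eRexp any_toks))
            (eConcat (eRexp any_toks) (ECall 8 [EVar 3, EVar 9, EVar 10]))))))"

definition pats_body :: expr where
  "pats_body =
   ECase (EVar 0) ELeaf (ECase (EVar 0) ELeaf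
     (ELet (ECall 8 [EVar 5, EVar 0, ECall 2 [EVar 1]])
       (ECase (EVar 4) (EVar 0) (eUnion (EVar 2) (ECall 9 [EVar 6, EVar 8])))))"

definition nnf_body :: expr where
  "nnf_body =
   ECase (EVar 0) ELeaf (ECase (EVar 0)
     (ENode ELeaf (ENode (EVar 3) (EVar 1)))
     (ECase (EVar 1)
       (ECall 10 [EVar 3, eNot (EVar 5)])
       (ECase (EVar 5) ELeaf
         (ENode (ENode (ECase (EVar 4) (EVar 9) (eNot (EVar 11))) ELeaf)
           (ENode (ECall 10 [EVar 0, EVar 9]) (ECall 10 [EVar 1, EVar 9]))))))"

definition leaf_list_body :: expr where
  "leaf_list_body =
   ECase (EVar 0) ELeaf (ECase (EVar 0)
     (ENode (EVar 1) (EVar 3))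
     (ECase (EVar 1)
       (ECall 11 [EVar 3, EVar 5])
       (ECase (EVar 5) ELeaf (ECall 11 [EVar 0, ECall 11 [EVar 1, EVar 9]]))))"

definition prog :: program where
  "prog = [main_body, trie_cons_body, trie_of_body, look_body, emit_body, text_body,
     texts_body, tok_body, pat_body, pats_body, nnf_body, leaf_list_body]"

lemma length_prog: "length prog = 12"
  by (simp add: prog_def)

text \<open>The bodies stay folded on the right-hand sides. Each run lemma unfolds only its own
  body, so a recursive call keeps the shape to which the induction hypothesis applies.\<close>

lemma prog_nth:
  "prog ! 0 = main_body"
  "prog ! Suc 0 = trie_cons_body"
  "prog ! 2 = trie_of_body"
  "prog ! 3 = look_body"
  "prog ! 4 = emit_body"
  "prog ! 5 = text_body"
  "prog ! 6 = texts_body"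
  "prog ! 7 = tok_body"
  "prog ! 8 = pat_body"
  "prog ! 9 = pats_body"
  "prog ! 10 = nnf_body"
  "prog ! 11 = leaf_list_body"
  by (simp_all add: prog_def)

lemmas run = big_step_iffs big_steps_iffs big_step_quote length_prog prog_nth

section \<open>Functions on trees that specify the program\<close>

abbreviation tT :: tree where "tT \<equiv> Node Leaf Leaf"
abbreviation tNot :: "tree \<Rightarrow> tree" where "tNot s \<equiv> (case s of Leaf \<Rightarrow> tT | Node _ _ \<Rightarrow> Leaf)"
abbreviation tConcat :: "tree \<Rightarrow> tree \<Rightarrow> tree" where "tConcat r s \<equiv> Node (enc_nat 1) (Node r s)"
abbreviation tUnion :: "tree \<Rightarrow> tree \<Rightarrow> tree" where "tUnion r s \<equiv> Node (enc_nat 2) (Node r s)"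

text \<open>In \<open>Node x (Node e d)\<close> the entry \<open>x\<close> has index 1,
  \<open>e\<close> holds the even indices and \<open>d\<close> the remaining odd ones. Insertion at
  the front shifts every index by one, hence the subtrees swap and the old root joins
  \<open>d\<close>.\<close>

fun trie_cons :: "tree \<Rightarrow> tree \<Rightarrow> tree" where
  "trie_cons x Leaf = Node x (Node Leaf Leaf)"
| "trie_cons x (Node y Leaf) = Leaf"
| "trie_cons x (Node y (Node e d)) = Node x (Node (trie_cons y d) e)"

fun trie_of :: "tree \<Rightarrow> tree" where
  "trie_of Leaf = Leaf"
| "trie_of (Node x r) = trie_cons x (trie_of r)"

text \<open>The argument \<open>c\<close> acts as entry 0 in front of the entries of
  \<open>t\<close>. The even positions of this sequence are \<open>c\<close> followed by
  \<open>e\<close>, the odd ones are \<open>y\<close> followed by \<open>d\<close>; each bit selects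
  one of the two.\<close>

fun look :: "tree \<Rightarrow> tree \<Rightarrow> tree \<Rightarrow> tree" where
  "look c t Leaf = c"
| "look c t (Node b r) = (case t of Leaf \<Rightarrow> c | Node y z \<Rightarrow> (case z of Leaf \<Rightarrow> c
     | Node e d \<Rightarrow> (case b of Leaf \<Rightarrow> look c e r | Node _ _ \<Rightarrow> look y d r)))"

text \<open>Accumulators replace the concatenation of lists, so each bit of the text is produced
  once.\<close>

fun emit :: "tree \<Rightarrow> tree \<Rightarrow> tree" where
  "emit Leaf acc = Node tT (Node tT (Node Leaf acc))"
| "emit (Node Leaf r) acc = Node Leaf (emit r acc)"
| "emit (Node (Node _ _) r) acc = Node tT (Node Leaf (emit r acc))"

fun text_tree :: "tree \<Rightarrow> tree \<Rightarrow> tree \<Rightarrow> tree \<Rightarrow> tree" where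
  "text_tree Leaf c t acc = acc"
| "text_tree (Node Leaf r) c t acc = Leaf"
| "text_tree (Node (Node y i) r) c t acc =
     emit (Node (case y of Leaf \<Rightarrow> look c t i | Node _ _ \<Rightarrow> tT) (Node y i)) (text_tree r c t acc)"

fun texts_tree :: "tree \<Rightarrow> tree \<Rightarrow> tree" where
  "texts_tree Leaf ls = Leaf"
| "texts_tree (Node Leaf r) ls = Leaf"
| "texts_tree (Node (Node x xs) r) ls = text_tree ls x (trie_of xs)
     (Node tT (Node tT (Node tT (Node Leaf (texts_tree r ls)))))"

fun tok_tree :: "tree \<Rightarrow> tree" where
  "tok_tree Leaf = enc_rexp tok_end"
| "tok_tree (Node Leaf r) = tConcat (enc_rexp (Sym False)) (tok_tree r)"
| "tok_tree (Node (Node _ _) r) =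
     tConcat (enc_rexp (Sym True)) (tConcat (enc_rexp (Sym False)) (tok_tree r))"

fun pat_tree :: "tree \<Rightarrow> tree \<Rightarrow> tree \<Rightarrow> tree" where
  "pat_tree (Node Leaf (Node s (Node y i))) c t =
     tok_tree (Node (case y of Leaf \<Rightarrow> tNot s
        | Node _ _ \<Rightarrow> (case look c t i of Leaf \<Rightarrow> s | Node _ _ \<Rightarrow> tNot s)) (Node y i))"
| "pat_tree (Node (Node q _) (Node f g)) c t = (case q of
      Leaf \<Rightarrow> tConcat (pat_tree f c t) (pat_tree g c t)
    | Node _ _ \<Rightarrow> tUnion (tConcat (pat_tree f c t) (enc_rexp any_toks))
        (tConcat (enc_rexp any_toks) (pat_tree g c t)))"
| "pat_tree Leaf c t = Leaf"
| "pat_tree (Node Leaf Leaf) c t = Leaf"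
| "pat_tree (Node Leaf (Node s Leaf)) c t = Leaf"
| "pat_tree (Node (Node q l) Leaf) c t = Leaf"

fun pats_tree :: "tree \<Rightarrow> tree \<Rightarrow> tree" where
  "pats_tree (Node (Node x xs) Leaf) g = pat_tree g x (trie_of xs)"
| "pats_tree (Node (Node x xs) r) g = tUnion (pat_tree g x (trie_of xs)) (pats_tree r g)"
| "pats_tree _ g = Leaf"

text \<open>The clauses tell the binary tags 0 to 3 apart by their length: no bit for a variable,
  one bit for \<open>Not\<close>, two bits for a gate, whose low bit \<open>d\<close> separates
  \<open>Or\<close> from \<open>And\<close>. The flag \<open>s\<close> records the parity of the
  negations passed.\<close>

fun nnf_tree :: "tree \<Rightarrow> tree \<Rightarrow> tree" where
  "nnf_tree (Node Leaf v) s = Node Leaf (Node s v)"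
| "nnf_tree (Node (Node d Leaf) f) Leaf = nnf_tree f tT"
| "nnf_tree (Node (Node d Leaf) f) (Node _ _) = nnf_tree f Leaf"
| "nnf_tree (Node (Node d (Node _ _)) (Node f g)) s =
     Node (Node (case d of Leaf \<Rightarrow> s | Node _ _ \<Rightarrow> tNot s) Leaf)
       (Node (nnf_tree f s) (nnf_tree g s))"
| "nnf_tree _ s = Leaf"

fun leaf_list :: "tree \<Rightarrow> tree \<Rightarrow> tree" where
  "leaf_list (Node Leaf v) acc = Node v acc"
| "leaf_list (Node (Node d Leaf) f) acc = leaf_list f acc"
| "leaf_list (Node (Node d (Node _ _)) (Node f g)) acc = leaf_list f (leaf_list g acc)"
| "leaf_list _ acc = Leaf"

section \<open>Exact running times of these functions\<close>

fun trie_cons_time :: "tree \<Rightarrow> nat" where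
  "trie_cons_time Leaf = 7"
| "trie_cons_time (Node y Leaf) = 5"
| "trie_cons_time (Node y (Node e d)) = trie_cons_time d + 11"

fun trie_of_time :: "tree \<Rightarrow> nat" where
  "trie_of_time Leaf = 3"
| "trie_of_time (Node x r) = trie_of_time r + trie_cons_time (trie_of r) + 6"

fun look_time :: "tree \<Rightarrow> tree \<Rightarrow> nat" where
  "look_time t Leaf = 3"
| "look_time t (Node b r) = (case t of Leaf \<Rightarrow> 5 | Node y z \<Rightarrow> (case z of Leaf \<Rightarrow> 7
     | Node e d \<Rightarrow> (case b of Leaf \<Rightarrow> look_time e r | Node _ _ \<Rightarrow> look_time d r) + 12))"

fun emit_time :: "tree \<Rightarrow> nat" where
  "emit_time Leaf = 13"
| "emit_time (Node Leaf r) = emit_time r + 9"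
| "emit_time (Node (Node _ _) r) = emit_time r + 13"

fun text_time :: "tree \<Rightarrow> tree \<Rightarrow> tree \<Rightarrow> nat" where
  "text_time Leaf c t = 3"
| "text_time (Node Leaf r) c t = 5"
| "text_time (Node (Node y i) r) c t =
     (case y of Leaf \<Rightarrow> look_time t i + 4 | Node _ _ \<Rightarrow> 3) +
     emit_time (Node (case y of Leaf \<Rightarrow> look c t i | Node _ _ \<Rightarrow> tT) (Node y i)) +
     text_time r c t + 14"

fun texts_time :: "tree \<Rightarrow> tree \<Rightarrow> nat" where
  "texts_time Leaf ls = 3"
| "texts_time (Node Leaf r) ls = 5"
| "texts_time (Node (Node x xs) r) ls =
     text_time ls x (trie_of xs) + trie_of_time xs + texts_time r ls + 26"

fun tok_time :: "tree \<Rightarrow> nat" where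
  "tok_time Leaf = 2 * size (enc_rexp tok_end) + 3"
| "tok_time (Node Leaf r) = tok_time r + 16"
| "tok_time (Node (Node _ _) r) = tok_time r + 28"

fun pat_time :: "tree \<Rightarrow> tree \<Rightarrow> tree \<Rightarrow> nat" where
  "pat_time (Node Leaf (Node s (Node y i))) c t = 13 +
     (case y of Leaf \<Rightarrow> (case s of Leaf \<Rightarrow> 5 | Node _ _ \<Rightarrow> 3)
        | Node _ _ \<Rightarrow> look_time t i + (case look c t i of Leaf \<Rightarrow> 6
          | Node _ _ \<Rightarrow> (case s of Leaf \<Rightarrow> 10 | Node _ _ \<Rightarrow> 8))) +
     tok_time (Node (case y of Leaf \<Rightarrow> tNot s
        | Node _ _ \<Rightarrow> (case look c t i of Leaf \<Rightarrow> s | Node _ _ \<Rightarrow> tNot s)) (Node y i))"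
| "pat_time (Node Leaf (Node s Leaf)) c t = 9"
| "pat_time (Node (Node q _) (Node f g)) c t = pat_time f c t + pat_time g c t +
     (case q of Leaf \<Rightarrow> 23 | Node _ _ \<Rightarrow> 4 * size (enc_rexp any_toks) + 41)"
| "pat_time (Node Leaf Leaf) c t = 7"
| "pat_time (Node (Node q l) Leaf) c t = 7"
| "pat_time Leaf c t = 3"

fun pats_time :: "tree \<Rightarrow> tree \<Rightarrow> nat" where
  "pats_time (Node (Node x xs) Leaf) g = pat_time g x (trie_of xs) + trie_of_time xs + 13"
| "pats_time (Node (Node x xs) (Node b r)) g =
     pat_time g x (trie_of xs) + trie_of_time xs + pats_time (Node b r) g + 25"
| "pats_time (Node Leaf r) g = 5"
| "pats_time Leaf g = 3"

fun nnf_time :: "tree \<Rightarrow> tree \<Rightarrow> nat" where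
  "nnf_time (Node Leaf v) s = 9"
| "nnf_time (Node (Node d Leaf) f) Leaf = nnf_time f tT + 13"
| "nnf_time (Node (Node d Leaf) f) (Node _ _) = nnf_time f Leaf + 11"
| "nnf_time (Node (Node d (Node _ _)) (Node f g)) s = nnf_time f s + nnf_time g s +
     (case d of Leaf \<Rightarrow> 21 | Node _ _ \<Rightarrow> (case s of Leaf \<Rightarrow> 25 | Node _ _ \<Rightarrow> 23))"
| "nnf_time (Node (Node d (Node _ _)) Leaf) s = 9"
| "nnf_time Leaf s = 3"

fun leaf_list_time :: "tree \<Rightarrow> tree \<Rightarrow> nat" where
  "leaf_list_time (Node Leaf v) acc = 7"
| "leaf_list_time (Node (Node d Leaf) f) acc = leaf_list_time f acc + 9"
| "leaf_list_time (Node (Node d (Node _ _)) (Node f g)) acc =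
     leaf_list_time f (leaf_list g acc) + leaf_list_time g acc + 13"
| "leaf_list_time (Node (Node d (Node _ _)) Leaf) acc = 9"
| "leaf_list_time Leaf acc = 3"

text \<open>The running times are equivalences rather than implications, so that the simplifier executes
  the program symbolically.\<close>

lemma run_trie_cons:
  "big_step prog [x, t] trie_cons_body v k \<longleftrightarrow> v = trie_cons x t \<and> k = trie_cons_time t"
  by (induction x t arbitrary: v k rule: trie_cons.induct; subst trie_cons_body_def;
      (simp add: run split: tree.split; fail |
       simp add: run split: tree.split, simp add: numeral_eq_Suc add_ac))

lemma run_trie_of:
  "big_step prog [t] trie_of_body v k \<longleftrightarrow> v = trie_of t \<and> k = trie_of_time t"
  by (induction t arbitrary: v k; subst trie_of_body_def;
      (simp add: run run_trie_cons split: tree.split; fail |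
       simp add: run run_trie_cons split: tree.split, simp add: numeral_eq_Suc add_ac))

lemma run_look:
  "big_step prog [c, t, p] look_body v k \<longleftrightarrow> v = look c t p \<and> k = look_time t p"
  by (induction c t p arbitrary: v k rule: look.induct; subst look_body_def;
      (simp add: run split: tree.split; fail |
       simp add: run split: tree.split, simp add: numeral_eq_Suc add_ac))

lemma run_emit:
  "big_step prog [w, acc] emit_body v k \<longleftrightarrow> v = emit w acc \<and> k = emit_time w"
  by (induction w acc arbitrary: v k rule: emit.induct; subst emit_body_def;
      (simp add: run split: tree.split; fail |
       simp add: run split: tree.split, simp add: numeral_eq_Suc add_ac))

lemma run_text:
  "big_step prog [ls, c, t, acc] text_body v k \<longleftrightarrow> v = text_tree ls c t acc \<and> k = text_time ls c t"
  by (induction ls c t acc arbitrary: v k rule: text_tree.induct; subst text_body_def;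
      (simp add: run run_look run_emit split: tree.split; fail |
       simp add: run run_look run_emit split: tree.split, simp add: numeral_eq_Suc add_ac))

lemma run_texts:
  "big_step prog [as, ls] texts_body v k \<longleftrightarrow> v = texts_tree as ls \<and> k = texts_time as ls"
  by (induction as ls arbitrary: v k rule: texts_tree.induct; subst texts_body_def;
      (simp add: run run_text run_trie_of split: tree.split; fail |
       simp add: run run_text run_trie_of split: tree.split, simp add: numeral_eq_Suc add_ac))

lemma run_tok:
  "big_step prog [w] tok_body v k \<longleftrightarrow> v = tok_tree w \<and> k = tok_time w"
  by (induction w arbitrary: v k rule: tok_tree.induct; subst tok_body_def;
      (simp add: run split: tree.split; fail |
       simp add: run split: tree.split, simp add: numeral_eq_Suc add_ac))

lemma run_pat:
  "big_step prog [g, c, t] pat_body v k \<longleftrightarrow> v = pat_tree g c t \<and> k = pat_time g c t"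
  by (induction g c t arbitrary: v k rule: pat_tree.induct; subst pat_body_def;
      (simp add: run run_tok run_look split: tree.split; fail |
       simp add: run run_tok run_look split: tree.split, simp add: numeral_eq_Suc add_ac))

lemma run_pats:
  "big_step prog [bs, g] pats_body v k \<longleftrightarrow> v = pats_tree bs g \<and> k = pats_time bs g"
  by (induction bs g arbitrary: v k rule: pats_tree.induct; subst pats_body_def;
      (simp add: run run_pat run_trie_of split: tree.split; fail |
       simp add: run run_pat run_trie_of split: tree.split, simp add: numeral_eq_Suc add_ac))

lemma run_nnf:
  "big_step prog [f, s] nnf_body v k \<longleftrightarrow> v = nnf_tree f s \<and> k = nnf_time f s"
  by (induction f s arbitrary: v k rule: nnf_tree.induct; subst nnf_body_def;
      (simp add: run split: tree.split; fail |
       simp add: run split: tree.split, simp add: numeral_eq_Suc add_ac))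

lemma run_leaf_list:
  "big_step prog [f, acc] leaf_list_body v k \<longleftrightarrow> v = leaf_list f acc \<and> k = leaf_list_time f acc"
  by (induction f acc arbitrary: v k rule: leaf_list.induct; subst leaf_list_body_def;
      (simp add: run split: tree.split; fail |
       simp add: run split: tree.split, simp add: numeral_eq_Suc add_ac))

definition output_tree :: "tree \<Rightarrow> tree \<Rightarrow> tree \<Rightarrow> tree \<Rightarrow> tree" where
  "output_tree ls g as bs =
     Node (Node Leaf (Node tT (Node tT (Node tT (Node Leaf (texts_tree as ls))))))
       (tConcat (enc_rexp (Sym False)) (tConcat (enc_rexp delim)
          (tConcat (pats_tree bs g) (enc_rexp delim))))"

lemma run_main:
  "big_step prog [Node f (Node as bs)] main_body v k \<longleftrightarrow>
    v = output_tree (leaf_list f Leaf) (nnf_tree f Leaf) as bs \<and>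
    k = nnf_time f Leaf + leaf_list_time f Leaf + texts_time as (leaf_list f Leaf) +
        pats_time bs (nnf_tree f Leaf) + 4 * size (enc_rexp delim) + 59"
  by (simp add: main_body_def run run_nnf run_leaf_list run_texts run_pats output_tree_def,
      simp add: numeral_eq_Suc add_ac)

section \<open>Correctness of the reduction\<close>

definition bit_code :: "bool \<Rightarrow> bool list" where
  "bit_code x = (if x then [True, False] else [False])"

definition tok_code :: "bool list \<Rightarrow> bool list" where
  "tok_code w = concat (map bit_code w) @ [True, True, False]"

definition toks_code :: "bool list list \<Rightarrow> bool list" where
  "toks_code ws = concat (map tok_code ws)"

definition delim_code :: "bool list" where
  "delim_code = [True, True, True, False]"

definition letters_code :: "nat list \<Rightarrow> bool list" where
  "letters_code js = concat (map (\<lambda>j. replicate j True @ [False]) js)"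

definition tok_letters :: "bool list \<Rightarrow> nat list" where
  "tok_letters w = map of_bool w @ [2]"

definition toks_letters :: "bool list list \<Rightarrow> nat list" where
  "toks_letters ws = concat (map tok_letters ws)"

lemma letters_code_simps [simp]:
  "letters_code [] = []"
  "letters_code (j # js) = replicate j True @ False # letters_code js"
  "letters_code (js @ ks) = letters_code js @ letters_code ks"
  by (simp_all add: letters_code_def)

lemma tok_code_letters: "tok_code w = letters_code (tok_letters w)"
  by (induction w) (auto simp: tok_code_def tok_letters_def bit_code_def numeral_eq_Suc)

lemma toks_code_letters: "toks_code ws = letters_code (toks_letters ws)"
  by (induction ws) (auto simp: toks_code_def toks_letters_def tok_code_letters)

lemma delim_code_letters: "delim_code = letters_code [3]"
  by (simp add: delim_code_def numeral_eq_Suc)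

lemma three_notin_toks_letters [simp]: "3 \<notin> set (toks_letters ws)"
  by (auto simp: toks_letters_def tok_letters_def of_bool_def split: if_splits)

text \<open>In a code word 1^j 0 the bit 0 occurs only at the end, so a cut after any 0 falls
  between two letters.\<close>

lemma letters_code_prefix:
  assumes "letters_code js = x @ False # y"
  shows "\<exists>j1 j2. js = j1 @ j2 \<and> letters_code j1 = x @ [False] \<and> letters_code j2 = y"
  using assms
proof (induction js arbitrary: x)
  case Nil
  then show ?case by simp
next
  case (Cons j js)
  from Cons.prems have "replicate j True @ (False # letters_code js) = x @ (False # y)" by simp
  \<comment> \<open>\<open>us\<close> is the difference between the ones of the first letter and
    \<open>x\<close>. If it is empty, the given 0 ends the first letter; otherwise the 0 lies in a
    later letter, because a run of ones contains no 0.\<close>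
  then obtain us where
    us: "replicate j True = x @ us \<and> us @ False # letters_code js = False # y \<or>
     replicate j True @ us = x \<and> False # letters_code js = us @ False # y"
    unfolding append_eq_append_conv2 by blast
  show ?case
  proof (cases us)
    case Nil
    with us have "x = replicate j True" "letters_code js = y" by auto
    then show ?thesis by (intro exI[of _ "[j]"] exI[of _ js]) simp
  next
    case (Cons u us')
    have "replicate j True \<noteq> x @ False # us'"
    proof
      assume "replicate j True = x @ False # us'"
      then have "False \<in> set (replicate j True)" by simp
      then show False by auto
    qed
    with us Cons have "replicate j True @ us = x \<and> False # letters_code js = us @ False # y"
      by (metis append_Cons list.inject)
    with Cons have x: "x = replicate j True @ False # us'" "letters_code js = us' @ False # y"
      by auto
    from Cons.IH[OF x(2)] obtain j1 j2 where
      "js = j1 @ j2" "letters_code j1 = us' @ [False]" "letters_code j2 = y" by blast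
    with x(1) show ?thesis by (intro exI[of _ "j # j1"] exI[of _ j2]) simp
  qed
qed

lemma letters_code_inject: "letters_code js = letters_code ks \<longleftrightarrow> js = ks"
proof
  assume "letters_code js = letters_code ks"
  then show "js = ks"
  proof (induction js arbitrary: ks)
    case Nil
    then show ?case by (cases ks) auto
  next
    case (Cons j js)
    then obtain k ks' where ks: "ks = k # ks'" by (cases ks) auto
    have aux: "j = k \<and> u = v" if "replicate j True @ False # u = replicate k True @ False # v"
      for u v
      using that
    proof (induction j arbitrary: k)
      case 0
      then show ?case by (cases k) auto
    next
      case (Suc j)
      then show ?case by (cases k) auto
    qed
    have "j = k" "letters_code js = letters_code ks'"
      using aux Cons.prems unfolding ks letters_code_simps by blast+
    then show ?case using Cons.IH ks by blast
  qed
qed simp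

lemma append_Cons_first_eq:
  "xs @ d # ys = us @ d # vs \<Longrightarrow> d \<notin> set xs \<Longrightarrow> d \<notin> set us \<Longrightarrow> xs = us \<and> ys = vs"
proof (induction xs arbitrary: us)
  case Nil
  then show ?case by (cases us) auto
next
  case (Cons x xs)
  then show ?case by (cases us) auto
qed

text \<open>The end marker 2 differs from the letters 0 and 1 of a token, so its first occurrence
  splits off the first token.\<close>

lemma toks_letters_inject: "toks_letters ws = toks_letters ws' \<longleftrightarrow> ws = ws'"
proof
  assume "toks_letters ws = toks_letters ws'"
  then show "ws = ws'"
  proof (induction ws arbitrary: ws')
    case Nil
    then show ?case by (cases ws') (auto simp: toks_letters_def tok_letters_def)
  next
    case (Cons w ws)
    then obtain v vs where ws': "ws' = v # vs"
      by (cases ws') (auto simp: toks_letters_def tok_letters_def)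
    have *: "2 \<notin> set (map of_bool u :: nat list)" for u
      by (auto simp: of_bool_def split: if_splits)
    have "map of_bool w @ 2 # toks_letters ws = map of_bool v @ 2 # toks_letters vs"
      using Cons.prems ws' by (simp add: toks_letters_def tok_letters_def)
    from append_Cons_first_eq[OF this * *]
    have "map of_bool w = (map of_bool v :: nat list)" "toks_letters ws = toks_letters vs"
      by blast+
    moreover have "inj (of_bool :: bool \<Rightarrow> nat)" by (auto simp: inj_def)
    ultimately have "w = v" "ws = vs" using Cons.IH inj_map_eq_map[of of_bool w v] by blast+
    then show ?case using ws' by simp
  qed
qed simp

lemma toks_code_inject: "toks_code ws = toks_code ws' \<longleftrightarrow> ws = ws'"
  by (simp add: toks_code_letters letters_code_inject toks_letters_inject)

text \<open>Consecutive blocks share a delimiter. A segment without \<open>d\<close> that stands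
  between two delimiters therefore fills a whole block.\<close>

lemma delimited_block:
  assumes "d # concat (map (\<lambda>a. f a @ [d]) As) = x @ d # u @ d # y"
    and "d \<notin> set u" and "\<And>a. d \<notin> set (f a)"
  shows "\<exists>a \<in> set As. u = f a"
  using assms(1)
proof (induction As arbitrary: x)
  case Nil
  then show ?case by (cases x) auto
next
  case (Cons a As)
  show ?case
  proof (cases x)
    case Nil
    with Cons.prems have "f a @ d # concat (map (\<lambda>a. f a @ [d]) As) = u @ d # y" by simp
    from append_Cons_first_eq[OF this assms(3) assms(2)] have "u = f a" by simp
    then show ?thesis by simp
  next
    case (Cons e x')
    then have "f a @ (d # concat (map (\<lambda>a. f a @ [d]) As)) = x' @ (d # u @ d # y)"
      using arg_cong[OF Cons.prems, of tl] by simp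
    then obtain us where
      us: "f a = x' @ us \<and> us @ d # concat (map (\<lambda>a. f a @ [d]) As) = d # u @ d # y \<or>
        f a @ us = x' \<and> d # concat (map (\<lambda>a. f a @ [d]) As) = us @ d # u @ d # y"
      unfolding append_eq_append_conv2 by blast
    \<comment> \<open>The occurrence does not start at the first delimiter, and \<open>f a\<close>
      contains none, so it starts at the delimiter after \<open>f a\<close> or later.\<close>
    have ex: "\<exists>z. d # concat (map (\<lambda>a. f a @ [d]) As) = z @ d # u @ d # y"
    proof (cases us)
      case Nil
      with us show ?thesis by (metis append_Nil append_Nil2)
    next
      case (Cons c us')
      have "d \<in> set (f a)" if "f a = x' @ us" "us @ d # concat (map (\<lambda>a. f a @ [d]) As) = d # u @ d # y"
        using that Cons by simp
      with us assms(3)[of a] show ?thesis by blast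
    qed
    from ex obtain z where "d # concat (map (\<lambda>a. f a @ [d]) As) = z @ d # u @ d # y" by blast
    from Cons.IH[OF this] show ?thesis by (meson list.set_intros(2))
  qed
qed

text \<open>The flag of a literal says that it is negated, the flag of a gate that it is a disjunction.\<close>

datatype nnf = Lit bool var | Gate bool nnf nnf

fun nnf_of :: "formula \<Rightarrow> bool \<Rightarrow> nnf" where
  "nnf_of (Var v) s = Lit s v"
| "nnf_of (Not F) s = nnf_of F (\<not> s)"
| "nnf_of (And F G) s = Gate s (nnf_of F s) (nnf_of G s)"
| "nnf_of (Or F G) s = Gate (\<not> s) (nnf_of F s) (nnf_of G s)"

fun nnf_leaves :: "nnf \<Rightarrow> var list" where
  "nnf_leaves (Lit s v) = [v]"
| "nnf_leaves (Gate q f g) = nnf_leaves f @ nnf_leaves g"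

fun nnf_holds :: "nnf \<Rightarrow> bool list \<Rightarrow> bool list \<Rightarrow> bool" where
  "nnf_holds (Lit s v) a b \<longleftrightarrow> holds (Var v) a b \<noteq> s"
| "nnf_holds (Gate q f g) a b \<longleftrightarrow>
     (if q then nnf_holds f a b \<or> nnf_holds g a b else nnf_holds f a b \<and> nnf_holds g a b)"

lemma nnf_leaves_of [simp]: "nnf_leaves (nnf_of F s) = leaves F"
  by (induction F arbitrary: s) auto

lemma nnf_holds_of: "nnf_holds (nnf_of F s) a b \<longleftrightarrow> holds F a b \<noteq> s"
  by (induction F arbitrary: s) auto

section \<open>Names of variables and truth values in tokens\<close>

fun nat_bits :: "nat \<Rightarrow> bool list" where
  "nat_bits n = (if n = 0 then [] else odd n # nat_bits (n div 2))"

declare nat_bits.simps [simp del]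

fun name :: "var \<Rightarrow> bool list" where
  "name (X i) = False # nat_bits i"
| "name (Y i) = True # nat_bits i"

lemma enc_nat_bits: "enc_list enc_bool (nat_bits n) = enc_nat n"
proof (induction n rule: less_induct)
  case (less n)
  then show ?case by (cases "n = 0") (simp_all add: nat_bits.simps[of n] nat_bits.simps[of 0] enc_nat.simps[of n])
qed

lemma enc_name: "enc_list enc_bool (name v) = enc_var v"
  by (cases v) (simp_all add: enc_nat_bits)

lemma name_inject: "name v = name w \<longleftrightarrow> v = w"
  by (cases v; cases w) (auto, (metis enc_nat_bits enc_nat_inject)+)

text \<open>The text sees only \<open>a\<close> and the pattern only \<open>b\<close>. The side that
  does not know the entry supplies a value fixed by the formula, so that equality of the two values
  evaluates the literal.\<close>

fun text_val :: "bool list \<Rightarrow> var \<Rightarrow> bool" where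
  "text_val a (X i) = a ! i"
| "text_val a (Y i) = True"

fun pat_val :: "bool list \<Rightarrow> bool \<Rightarrow> var \<Rightarrow> bool" where
  "pat_val b s (X i) = (\<not> s)"
| "pat_val b s (Y i) = (b ! i \<noteq> s)"

lemma text_val_eq_pat_val: "text_val a v = pat_val b s v \<longleftrightarrow> holds (Var v) a b \<noteq> s"
  by (cases v) auto

section \<open>Token sequences of texts and patterns\<close>

definition text_toks :: "bool list \<Rightarrow> var list \<Rightarrow> bool list list" where
  "text_toks a vs = map (\<lambda>v. text_val a v # name v) vs"

fun pat_toks :: "bool list \<Rightarrow> nnf \<Rightarrow> bool list list set" where
  "pat_toks b (Lit s v) = {[pat_val b s v # name v]}"
| "pat_toks b (Gate q f g) =
     (if q then {u @ w |u w. u \<in> pat_toks b f} \<union> {u @ w |u w. w \<in> pat_toks b g}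
      else {u @ w |u w. u \<in> pat_toks b f \<and> w \<in> pat_toks b g})"

text \<open>Only membership of the tokens is assumed, not their order. This hypothesis passes to
  both factors of a split \<open>u @ w\<close>, wherever ANY* stops, and at a literal the unique
  name forces the values to agree.\<close>

lemma nnf_holds_if_toks:
  "u \<in> pat_toks b g \<Longrightarrow> set u \<subseteq> range (\<lambda>v. text_val a v # name v) \<Longrightarrow> nnf_holds g a b"
proof (induction g arbitrary: u)
  case (Lit s v)
  then show ?case using text_val_eq_pat_val[of a v b s] by (auto simp: name_inject)
next
  case (Gate q f g)
  then show ?case by (fastforce split: if_splits)
qed

text \<open>The tokens of a gate are those of \<open>f\<close> followed by those of
  \<open>g\<close>. At a disjunction the true side is matched and ANY* absorbs the other.\<close>

lemma text_toks_if_nnf_holds: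
  "nnf_holds g a b \<Longrightarrow> text_toks a (nnf_leaves g) \<in> pat_toks b g"
proof (induction g)
  case (Lit s v)
  then show ?case using text_val_eq_pat_val[of a v b s] by (simp add: text_toks_def)
next
  case (Gate q f g)
  then show ?case by (auto simp: text_toks_def split: if_splits)
qed

lemma text_toks_pat_toks_iff:
  "text_toks a (nnf_leaves g) \<in> pat_toks b g \<longleftrightarrow> nnf_holds g a b"
  using nnf_holds_if_toks text_toks_if_nnf_holds by (fastforce simp: text_toks_def)

section \<open>Regular expressions and their languages\<close>

fun tok_rexp :: "bool list \<Rightarrow> bool rexp" where
  "tok_rexp [] = tok_end"
| "tok_rexp (x # w) = (if x then Concat (Sym True) (Concat (Sym False) (tok_rexp w))
     else Concat (Sym False) (tok_rexp w))"

fun pat :: "bool list \<Rightarrow> nnf \<Rightarrow> bool rexp" where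
  "pat b (Lit s v) = tok_rexp (pat_val b s v # name v)"
| "pat b (Gate q f g) =
     (if q then Union (Concat (pat b f) any_toks) (Concat any_toks (pat b g))
      else Concat (pat b f) (pat b g))"

text \<open>No \<open>rexp\<close> has an empty language, so the recursion ends at a single vector.
  The value at the empty list is a dummy, excluded below by \<open>bs \<noteq> []\<close>.\<close>

fun pats :: "bool list list \<Rightarrow> nnf \<Rightarrow> bool rexp" where
  "pats [b] g = pat b g"
| "pats (b # bs) g = Union (pat b g) (pats bs g)"
| "pats [] g = Sym False"

lemma lang_tok_end: "lang tok_end = {[True, True, False]}"
  by (auto simp: tok_end_def)

lemma lang_tok_rexp: "lang (tok_rexp w) = {tok_code w}"
  by (induction w) (auto simp: lang_tok_end tok_code_def bit_code_def)

lemma lang_any_bit: "lang any_bit = range bit_code"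
  by (auto simp: any_bit_def bit_code_def image_def)

lemma lang_Star_image: "lang r = range f \<Longrightarrow> lang (Star r) = range (\<lambda>xs. concat (map f xs))"
proof safe
  fix u assume r: "lang r = range f" and "u \<in> lang (Star r)"
  then obtain ws where ws: "u = concat ws" "set ws \<subseteq> range f" by auto
  then obtain xs where "ws = map f xs" by (metis ex_map_conv subsetD rangeE)
  with ws show "u \<in> range (\<lambda>xs. concat (map f xs))" by auto
next
  fix xs assume "lang r = range f"
  then show "concat (map f xs) \<in> lang (Star r)" by (auto intro!: exI[of _ "map f xs"])
qed

lemma lang_any_toks: "lang any_toks = range toks_code"
proof -
  have "lang (Concat (Star any_bit) tok_end) = range tok_code"
    using lang_Star_image[OF lang_any_bit] by (auto simp: lang_tok_end tok_code_def)
  from lang_Star_image[OF this] show ?thesis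
    by (simp add: any_toks_def toks_code_def cong: image_cong)
qed

lemma toks_code_append [simp]:
  "toks_code [] = []" "toks_code (w # ws) = tok_code w @ toks_code ws"
  "toks_code (us @ ws) = toks_code us @ toks_code ws"
  by (simp_all add: toks_code_def)

lemma lang_pat: "lang (pat b g) = toks_code ` pat_toks b g"
proof (induction g)
  case (Lit s v)
  show ?case by (simp only: pat.simps lang_tok_rexp pat_toks.simps) simp
next
  case (Gate q f g)
  have cat: "{u @ w |u w. u \<in> toks_code ` U \<and> w \<in> toks_code ` W} =
      toks_code ` {u @ w |u w. u \<in> U \<and> w \<in> W}" for U W
  proof safe
    fix u w assume "u \<in> U" "w \<in> W"
    then show "toks_code u @ toks_code w \<in> toks_code ` {u @ w |u w. u \<in> U \<and> w \<in> W}"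
      by (metis (mono_tags, lifting) image_eqI mem_Collect_eq toks_code_append(3))
  qed auto
  show ?case
    \<comment> \<open>\<open>UNIV\<close> is the set of token sequences described by
      \<open>any_toks\<close>.\<close>
    using cat[of "pat_toks b f" UNIV] cat[of UNIV "pat_toks b g"]
      cat[of "pat_toks b f" "pat_toks b g"]
    by (simp add: Gate.IH lang_any_toks image_Un)
qed

lemma lang_pats: "bs \<noteq> [] \<Longrightarrow> lang (pats bs g) = (\<Union>b \<in> set bs. lang (pat b g))"
  by (induction bs g rule: pats.induct) auto

text \<open>The leading 0 imitates the end of a preceding letter, so that a pattern starting with 0
  can match at the first block too.\<close>

definition full_text :: "var list \<Rightarrow> bool list list \<Rightarrow> bool list" where
  "full_text vs As = False # delim_code @ concat (map (\<lambda>a. toks_code (text_toks a vs) @ delim_code) As)"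

definition pattern :: "nnf \<Rightarrow> bool list list \<Rightarrow> bool rexp" where
  "pattern g bs = Concat (Sym False) (Concat delim (Concat (pats bs g) delim))"

lemma lang_delim: "lang delim = {delim_code}"
  by (auto simp: delim_def delim_code_def)

lemma lang_pattern:
  "bs \<noteq> [] \<Longrightarrow> lang (pattern g bs) =
     {False # delim_code @ toks_code w @ delim_code |w b. b \<in> set bs \<and> w \<in> pat_toks b g}"
  by (auto simp: pattern_def lang_delim lang_pats lang_pat; blast)

lemma text_letters: "full_text vs As = False # letters_code (3 # concat (map (\<lambda>a.
    toks_letters (text_toks a vs) @ [3]) As))"
  by (induction As) (auto simp: full_text_def delim_code_letters toks_code_letters)

text \<open>The initial 0 puts the rest of the occurrence on a letter boundary; unique decoding and
  \<open>delimited_block\<close> then identify the block. Conversely, every delimiter of the text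
  follows a 0.\<close>

lemma sublist_text_iff:
  "sublist (False # delim_code @ toks_code w @ delim_code) (full_text vs As) \<longleftrightarrow>
    (\<exists>a \<in> set As. w = text_toks a vs)"
proof
  assume "sublist (False # delim_code @ toks_code w @ delim_code) (full_text vs As)"
  then obtain x y where "full_text vs As = x @ (False # delim_code @ toks_code w @ delim_code) @ y"
    by (auto simp: sublist_def)
  moreover define L where
    "L = 3 # concat (map (\<lambda>a. toks_letters (text_toks a vs) @ [3]) As)"
  ultimately have L: "False # letters_code L =
      x @ False # letters_code (3 # toks_letters w @ [3]) @ y"
    by (simp add: text_letters L_def delim_code_letters toks_code_letters)
  have "\<exists>L1 L2. L = L1 @ L2 \<and> letters_code L2 = letters_code (3 # toks_letters w @ [3]) @ y"
  proof (cases x)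
    case Nil
    with L show ?thesis by (intro exI[of _ "[]"] exI[of _ L] conjI) simp_all
  next
    case (Cons c x')
    with L have "letters_code L = x' @ False # letters_code (3 # toks_letters w @ [3]) @ y"
      by simp
    from letters_code_prefix[OF this] show ?thesis by metis
  qed
  \<comment> \<open>The last bit of the closing delimiter is split off, since
    \<open>letters_code_prefix\<close> cuts after a given 0.\<close>
  then obtain L1 L2 where L12: "L = L1 @ L2"
    "letters_code L2 = letters_code (3 # toks_letters w) @ (True # True # True # []) @ False # y"
    by (auto simp: numeral_eq_Suc)
  from letters_code_prefix[of L2 "letters_code (3 # toks_letters w) @ [True, True, True]" y]
  obtain L3 L4 where "L2 = L3 @ L4"
    "letters_code L3 = letters_code (3 # toks_letters w) @ [True, True, True] @ [False]"
    using L12(2) by auto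
  then have "letters_code L3 = letters_code (3 # toks_letters w @ [3])"
    by (simp add: numeral_eq_Suc)
  then have "L3 = 3 # toks_letters w @ [3]" by (simp only: letters_code_inject)
  with \<open>L2 = L3 @ L4\<close> L12(1) have "L = L1 @ 3 # toks_letters w @ 3 # L4" by simp
  then obtain a where "a \<in> set As" "toks_letters w = toks_letters (text_toks a vs)"
    using delimited_block[of 3 "\<lambda>a. toks_letters (text_toks a vs)" As L1 "toks_letters w" L4]
    unfolding L_def by auto
  then show "\<exists>a \<in> set As. w = text_toks a vs" by (auto simp: toks_letters_inject)
next
  assume "\<exists>a \<in> set As. w = text_toks a vs"
  then obtain a where a: "a \<in> set As" "w = text_toks a vs" by blast
  then obtain As1 As2 where As: "As = As1 @ a # As2" by (meson split_list)
  define K where "K = concat (map (\<lambda>a. toks_letters (text_toks a vs) @ [3]) As1)"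
  have ends: "\<exists>z. False # letters_code js = z @ [False]" for js
    by (cases js rule: rev_cases) auto
  \<comment> \<open>The delimiter in front of block \<open>a\<close> follows the leading 0 of the
    text if \<open>As1\<close> is empty, and otherwise the 0 that ends the letter before it.\<close>
  have "\<exists>z. False # letters_code (3 # K) = z @ False # delim_code"
  proof (cases K rule: rev_cases)
    case Nil
    then show ?thesis by (intro exI[of _ "[]"]) (simp add: delim_code_letters)
  next
    case (snoc K' j)
    then have "j = 3"
      unfolding K_def by (cases As1 rule: rev_cases) auto
    moreover obtain z where "False # letters_code (3 # K') = z @ [False]" using ends by blast
    ultimately show ?thesis using snoc
      by (intro exI[of _ z]) (simp add: delim_code_letters)
  qed
  then obtain z where "False # letters_code (3 # K) = z @ False # delim_code" by blast
  moreover have "full_text vs As = (False # letters_code (3 # K)) @ toks_code w @ delim_code @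
      letters_code (concat (map (\<lambda>a. toks_letters (text_toks a vs) @ [3]) As2))"
    unfolding text_letters K_def As a(2) by (simp add: delim_code_letters toks_code_letters)
  ultimately have "full_text vs As = z @ (False # delim_code @ toks_code w @ delim_code) @
      letters_code (concat (map (\<lambda>a. toks_letters (text_toks a vs) @ [3]) As2))"
    by simp
  then show "sublist (False # delim_code @ toks_code w @ delim_code) (full_text vs As)"
    by (metis sublist_appendI)
qed

lemma matches_pattern_iff:
  assumes "bs \<noteq> []"
  shows "matches_substring (pattern g bs) (full_text (nnf_leaves g) As) \<longleftrightarrow>
    (\<exists>a \<in> set As. \<exists>b \<in> set bs. nnf_holds g a b)"
proof -
  have "matches_substring (pattern g bs) (full_text (nnf_leaves g) As) \<longleftrightarrow>
      (\<exists>w. \<exists>b \<in> set bs. w \<in> pat_toks b g \<and> (\<exists>a \<in> set As. w = text_toks a (nnf_leaves g)))"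
    unfolding matches_substring_def lang_pattern[OF assms] sublist_text_iff[symmetric] by blast
  also have "\<dots> \<longleftrightarrow>
      (\<exists>a \<in> set As. \<exists>b \<in> set bs. text_toks a (nnf_leaves g) \<in> pat_toks b g)"
    by blast
  finally show ?thesis by (simp only: text_toks_pat_toks_iff)
qed

section \<open>The program computes the reduction\<close>

fun enc_nnf :: "nnf \<Rightarrow> tree" where
  "enc_nnf (Lit s v) = Node Leaf (Node (enc_bool s) (enc_var v))"
| "enc_nnf (Gate q f g) = Node (Node (enc_bool q) Leaf) (Node (enc_nnf f) (enc_nnf g))"

lemma case_enc_bool [simp]:
  "(case enc_bool x of Leaf \<Rightarrow> u | Node l r \<Rightarrow> w l r) = (if x then w Leaf Leaf else u)"
  by (cases x) auto

lemma nnf_tree_enc: "nnf_tree (enc_formula F) (enc_bool s) = enc_nnf (nnf_of F s)"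
proof (induction F arbitrary: s)
  case (Not F)
  show ?case using Not[of "\<not> s"] by (cases s) auto
next
  case (And F G)
  then show ?case using And[of s] by simp
next
  case (Or F G)
  then show ?case using Or[of s] by (cases s) simp_all
qed simp

lemma leaf_list_enc:
  "leaf_list (enc_formula F) (enc_list enc_var vs) = enc_list enc_var (leaves F @ vs)"
  by (induction F arbitrary: vs) auto

lemma emit_enc:
  "emit (enc_list enc_bool w) (enc_list enc_bool acc) = enc_list enc_bool (tok_code w @ acc)"
proof (induction w)
  case (Cons x w)
  then show ?case by (cases x) (auto simp: tok_code_def bit_code_def)
qed (simp add: tok_code_def)

lemma tok_tree_enc: "tok_tree (enc_list enc_bool w) = enc_rexp (tok_rexp w)"
proof (induction w)
  case (Cons x w)
  then show ?case by (cases x) auto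
qed simp

text \<open>The trees built by \<^const>\<open>trie_cons\<close> are Braun trees with one-based indices: the entry with
  index \<open>i\<close> is found by following the bits of \<open>i\<close> from the least significant one on.\<close>

fun braun :: "nat \<Rightarrow> tree \<Rightarrow> bool" where
  "braun n Leaf \<longleftrightarrow> n = 0"
| "braun n (Node x Leaf) \<longleftrightarrow> False"
| "braun n (Node x (Node e d)) \<longleftrightarrow> n > 0 \<and> braun (n div 2) e \<and> braun ((n - 1) div 2) d"

lemma braun_trie_cons: "braun n t \<Longrightarrow> braun (Suc n) (trie_cons x t)"
proof (induction x t arbitrary: n rule: trie_cons.induct)
  case (3 x y e d)
  then have "braun (Suc ((n - 1) div 2)) (trie_cons y d)" "n > 0" by auto
  moreover have "Suc ((n - 1) div 2) = Suc n div 2" using \<open>n > 0\<close> by presburger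
  ultimately show ?case using 3 by auto
qed auto

lemma braun_trie_of: "braun (length xs) (trie_of (enc_list enc xs))"
  by (induction xs) (auto simp: braun_trie_cons)

lemma enc_nat_double:
  "i > 0 \<Longrightarrow> enc_nat (2 * i) = Node Leaf (enc_nat i)"
  "enc_nat (Suc (2 * i)) = Node (Node Leaf Leaf) (enc_nat i)"
  by (subst enc_nat.simps, simp)+

text \<open>An even index becomes odd and is sought in the moved subtree \<open>e\<close>; an odd
  one becomes even and is sought in \<open>trie_cons y d\<close>, where the induction hypothesis
  applies with half the index.\<close>

lemma look_trie_cons:
  "braun n t \<Longrightarrow> i \<le> n \<Longrightarrow> look c (trie_cons x t) (enc_nat (Suc i)) = look x t (enc_nat i)"
proof (induction x t arbitrary: n i c rule: trie_cons.induct)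
  case (1 x)
  then show ?case by simp
next
  case (2 x y)
  then show ?case by simp
next
  case (3 x y e d)
  show ?case
  proof (cases "even i")
    case True
    then obtain j where "i = 2 * j" by blast
    then show ?thesis by (cases "j = 0") (simp_all add: enc_nat_double)
  next
    case False
    then obtain j where j: "i = Suc (2 * j)" using oddE by fastforce
    then have "Suc i = 2 * Suc j" by simp
    moreover have "j \<le> (n - 1) div 2" using 3(3) j by auto
    ultimately show ?thesis using 3(1)[of "(n - 1) div 2" j c] 3(2) j
      by (simp add: enc_nat_double del: mult_Suc_right)
  qed
qed

text \<open>The head of a vector is entry 0 and is passed as first argument; only the tail is
  stored, with one-based indices. Hence the bound is \<open>i \<le> length xs\<close>.\<close>

lemma look_trie_of:
  "i \<le> length xs \<Longrightarrow> look (enc x) (trie_of (enc_list enc xs)) (enc_nat i) = enc ((x # xs) ! i)"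
proof (induction xs arbitrary: x i)
  case Nil
  then show ?case by simp
next
  case (Cons y xs)
  show ?case
  proof (cases i)
    case 0
    then show ?thesis by simp
  next
    case (Suc j)
    then show ?thesis
      using Cons look_trie_cons[OF braun_trie_of, of j xs "enc x" "enc y" enc] by simp
  qed
qed

lemma text_tree_enc:
  assumes "\<And>i. X i \<in> set vs \<Longrightarrow> i \<le> length xs"
  shows "text_tree (enc_list enc_var vs) (enc_bool x) (trie_of (enc_list enc_bool xs))
      (enc_list enc_bool acc) =
    enc_list enc_bool (toks_code (text_toks (x # xs) vs) @ acc)"
  using assms
proof (induction vs)
  case Nil
  then show ?case by (simp add: text_toks_def)
next
  case (Cons v vs)
  let ?acc = "toks_code (text_toks (x # xs) vs) @ acc"
  have "text_tree (enc_list enc_var (v # vs)) (enc_bool x) (trie_of (enc_list enc_bool xs))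
      (enc_list enc_bool acc) =
    emit (Node (enc_bool (text_val (x # xs) v)) (enc_var v)) (enc_list enc_bool ?acc)"
    using Cons by (cases v) (simp_all add: look_trie_of)
  also have "\<dots> = emit (enc_list enc_bool (text_val (x # xs) v # name v)) (enc_list enc_bool ?acc)"
    by (simp only: enc_list.simps enc_name)
  finally show ?case by (simp add: emit_enc text_toks_def del: enc_list.simps)
qed

lemma texts_tree_enc:
  assumes "\<And>a. a \<in> set As \<Longrightarrow> a \<noteq> []"
    and "\<And>a i. a \<in> set As \<Longrightarrow> X i \<in> set vs \<Longrightarrow> i < length a"
  shows "texts_tree (enc_list (enc_list enc_bool) As) (enc_list enc_var vs) =
    enc_list enc_bool (concat (map (\<lambda>a. toks_code (text_toks a vs) @ delim_code) As))"
  using assms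
proof (induction As)
  case Nil
  then show ?case by simp
next
  case (Cons a As)
  then obtain x xs where a: "a = x # xs" by (cases a) auto
  have *: "i \<le> length xs" if "X i \<in> set vs" for i
    using Cons.prems(2)[of a i] that a by simp
  show ?case
    using text_tree_enc[OF *, of vs x "delim_code @ concat (map (\<lambda>a. toks_code (text_toks a vs) @ delim_code) As)"]
      Cons a by (simp add: delim_code_def)
qed

lemma pat_tree_enc:
  assumes "\<And>i. Y i \<in> set (nnf_leaves g) \<Longrightarrow> i \<le> length xs"
  shows "pat_tree (enc_nnf g) (enc_bool x) (trie_of (enc_list enc_bool xs)) =
    enc_rexp (pat (x # xs) g)"
  using assms
proof (induction g)
  case (Lit s v)
  have "pat_tree (enc_nnf (Lit s v)) (enc_bool x) (trie_of (enc_list enc_bool xs)) =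
      tok_tree (Node (enc_bool (pat_val (x # xs) s v)) (enc_var v))"
    using Lit by (cases v; cases s) (simp_all add: look_trie_of)
  also have "\<dots> = tok_tree (enc_list enc_bool (pat_val (x # xs) s v # name v))"
    by (simp only: enc_list.simps enc_name)
  finally show ?case by (simp only: tok_tree_enc pat.simps)
next
  case (Gate q f g)
  then show ?case by simp
qed

lemma pats_tree_enc:
  assumes "Bs \<noteq> []" "\<And>b. b \<in> set Bs \<Longrightarrow> b \<noteq> []"
    and "\<And>b i. b \<in> set Bs \<Longrightarrow> Y i \<in> set (nnf_leaves g) \<Longrightarrow> i < length b"
  shows "pats_tree (enc_list (enc_list enc_bool) Bs) (enc_nnf g) = enc_rexp (pats Bs g)"
  using assms
proof (induction Bs)
  case Nil
  then show ?case by simp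
next
  case (Cons b Bs)
  then obtain x xs where b: "b = x # xs" by (cases b) auto
  have *: "i \<le> length xs" if "Y i \<in> set (nnf_leaves g)" for i
    using Cons.prems(3)[of b i] that b by simp
  show ?case
    using pat_tree_enc[OF *, of g x] Cons b by (cases Bs) simp_all
qed

lemma leaves_nonempty: "leaves F \<noteq> []"
  by (induction F) auto

lemma output_tree_enc:
  assumes "formula_pair_instance m n F As Bs" "n \<ge> 1"
  shows "output_tree (leaf_list (enc_formula F) Leaf) (nnf_tree (enc_formula F) Leaf)
      (enc_list (enc_list enc_bool) As) (enc_list (enc_list enc_bool) Bs) =
    enc_output (full_text (leaves F) As) (pattern (nnf_of F False) Bs)"
proof -
  have lv: "set (leaves F) = X ` {..<m} \<union> Y ` {..<m}"
    and A: "\<And>a. a \<in> set As \<Longrightarrow> length a = m" and B: "\<And>b. b \<in> set Bs \<Longrightarrow> length b = m"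
    and Bs: "Bs \<noteq> []"
    using assms by (auto simp: formula_pair_instance_def each_variable_once_def enumerates_vectors_def)
  \<comment> \<open>A formula has a leaf, so the vectors are nonempty and split into head and
    tail.\<close>
  have "m > 0" using lv leaves_nonempty[of F] by (cases m) auto
  have t: "texts_tree (enc_list (enc_list enc_bool) As) (enc_list enc_var (leaves F)) =
      enc_list enc_bool (concat (map (\<lambda>a. toks_code (text_toks a (leaves F)) @ delim_code) As))"
    using A lv \<open>m > 0\<close> by (intro texts_tree_enc) auto
  have p: "pats_tree (enc_list (enc_list enc_bool) Bs) (enc_nnf (nnf_of F False)) =
      enc_rexp (pats Bs (nnf_of F False))"
    using B Bs lv \<open>m > 0\<close> by (intro pats_tree_enc) auto
  show ?thesis
    using leaf_list_enc[of F "[]"] nnf_tree_enc[of F False] t p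
    by (simp add: output_tree_def enc_output_def full_text_def pattern_def delim_code_def)
qed

section \<open>Running time and output size\<close>

abbreviation nat_len :: "nat \<Rightarrow> nat" where
  "nat_len n \<equiv> length (nat_bits n)"

lemma nat_len_pos: "n > 0 \<Longrightarrow> nat_len n = Suc (nat_len (n div 2))"
  by (simp add: nat_bits.simps[of n])

lemma nat_len_0 [simp]: "nat_len 0 = 0"
  by (simp add: nat_bits.simps)

lemma two_power_nat_len: "n > 0 \<Longrightarrow> 2 ^ nat_len n \<le> 2 * n"
proof (induction n rule: less_induct)
  case (less n)
  show ?case
  proof (cases "n div 2 = 0")
    case True
    then have "n = 1" using less.prems by simp
    then show ?thesis by (simp add: nat_len_pos)
  next
    case False
    then have "2 ^ nat_len (n div 2) \<le> 2 * (n div 2)" using less by auto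
    then show ?thesis using less.prems by (simp add: nat_len_pos)
  qed
qed

lemma length_tok_code:
  "length w + 3 \<le> length (tok_code w)" "length (tok_code w) \<le> 2 * length w + 3"
  by (induction w) (auto simp: tok_code_def bit_code_def)

lemma rexp_length_tok_rexp: "rexp_length (tok_rexp w) = length (tok_code w)"
  by (induction w) (auto simp: tok_code_def bit_code_def tok_end_def)

lemma rexp_length_pos: "rexp_length r > 0"
  by (induction r) auto

lemma rexp_length_any_toks: "rexp_length any_toks = 15"
  by (simp add: any_toks_def any_bit_def tok_end_def)

text \<open>Each call passes to \<open>d\<close>, which has \<open>(n - 1) div 2\<close> entries, so
  \<open>Suc n\<close> loses one bit per call.\<close>

lemma trie_cons_time_le: "braun n t \<Longrightarrow> trie_cons_time t \<le> 11 * nat_len (Suc n)"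
proof (induction t arbitrary: n rule: trie_cons_time.induct)
  case 1
  then show ?case by (simp add: nat_len_pos)
next
  case (3 y e d)
  then have "trie_cons_time d \<le> 11 * nat_len (Suc ((n - 1) div 2))" "n > 0" by auto
  moreover have "Suc ((n - 1) div 2) = Suc n div 2" using \<open>n > 0\<close> by presburger
  ultimately show ?case using nat_len_pos[of "Suc n"] by simp
qed simp

text \<open>The bound stays a sum of bit lengths of indices: the names of the variables contain the
  same bits, so the output pays for building the tree.\<close>

lemma trie_of_time_le:
  "trie_of_time (enc_list enc xs) \<le> 3 + 17 * (\<Sum>i<Suc (length xs). nat_len i)"
proof (induction xs)
  case Nil
  then show ?case by simp
next
  case (Cons x xs)
  have "trie_cons_time (trie_of (enc_list enc xs)) \<le> 11 * nat_len (Suc (length xs))"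
    by (rule trie_cons_time_le[OF braun_trie_of])
  moreover have "nat_len (Suc (length xs)) \<ge> 1" by (simp add: nat_len_pos)
  ultimately show ?case using Cons by simp
qed

lemma look_time_le: "look_time t (enc_nat i) \<le> 12 * nat_len i + 7"
proof -
  have "look_time t (enc_list enc_bool w) \<le> 12 * length w + 7" for w
  proof (induction w arbitrary: t)
    case (Cons x w)
    have "look_time t' (enc_list enc_bool w) \<le> 7 + 12 * length w" for t'
      using Cons[of t'] by simp
    then show ?case by (auto split: tree.split)
  qed simp
  from this[of "nat_bits i"] show ?thesis by (simp add: enc_nat_bits)
qed

lemma emit_time_le: "emit_time (Node z (enc_var v)) \<le> 13 * length (name v) + 26"
proof -
  have "emit_time (enc_list enc_bool w) \<le> 13 * length w + 13" for w
  proof (induction w)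
    case (Cons x w)
    then show ?case by (cases x) auto
  qed simp
  from this[of "name v"] show ?thesis by (cases z) (simp_all add: enc_name)
qed

lemma tok_time_le: "tok_time (Node z (enc_var v)) \<le> 28 * length (name v) + 57"
proof -
  have "tok_time (enc_list enc_bool w) \<le> 28 * length w + 29" for w
  proof (induction w)
    case Nil
    show ?case by (simp add: tok_end_def)
  next
    case (Cons x w)
    then show ?case by (cases x) auto
  qed
  from this[of "name v"] show ?thesis by (cases z) (simp_all add: enc_name)
qed

lemma length_toks_code_ge:
  "(\<Sum>v\<leftarrow>vs. length (name v)) \<le> length (toks_code (text_toks a vs))"
proof (induction vs)
  case (Cons v vs)
  then show ?case using length_tok_code(1)[of "text_val a v # name v"]
    by (simp add: text_toks_def)
qed simp

lemma text_time_le: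
  "text_time (enc_list enc_var vs) c t \<le> 3 + 26 * length (toks_code (text_toks a vs))"
proof (induction vs)
  case Nil
  then show ?case by simp
next
  case (Cons v vs)
  have tok: "length (name v) + 4 \<le> length (tok_code (text_val a v # name v))"
    using length_tok_code(1)[of "text_val a v # name v"] by simp
  have "text_time (enc_list enc_var (v # vs)) c t \<le>
      26 * length (name v) + 104 + text_time (enc_list enc_var vs) c t"
  proof (cases v)
    case (X i)
    then show ?thesis using look_time_le[of t i] emit_time_le[of "look c t (enc_nat i)" v] by simp
  next
    case (Y i)
    then show ?thesis using emit_time_le[of tT v] by simp
  qed
  with Cons tok show ?case by (simp add: text_toks_def)
qed

text \<open>Tokens pay for reading and for building the tree; the delimiter of each block pays for
  the constant overhead per vector.\<close>

lemma texts_time_le: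
  assumes "\<And>a. a \<in> set As \<Longrightarrow> a \<noteq> [] \<and> (\<Sum>i<length a. nat_len i) \<le> (\<Sum>v\<leftarrow>vs. length (name v))"
  shows "texts_time (enc_list (enc_list enc_bool) As) (enc_list enc_var vs) \<le>
    50 * length (full_text vs As)"
proof -
  have "texts_time (enc_list (enc_list enc_bool) As) (enc_list enc_var vs) \<le>
    3 + 50 * length (concat (map (\<lambda>a. toks_code (text_toks a vs) @ delim_code) As))"
    using assms
  proof (induction As)
    case Nil
    then show ?case by simp
  next
    case (Cons a As)
    then obtain x xs where a: "a = x # xs" by (cases a) auto
    have "(\<Sum>i<Suc (length xs). nat_len i) \<le> length (toks_code (text_toks a vs))"
      using Cons.prems[of a] length_toks_code_ge[of vs a] a by simp
    moreover have "texts_time (enc_list (enc_list enc_bool) As) (enc_list enc_var vs) \<le>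
      3 + 50 * length (concat (map (\<lambda>a. toks_code (text_toks a vs) @ delim_code) As))"
      using Cons by simp
    ultimately show ?case
      using text_time_le[of vs "enc_bool x" "trie_of (enc_list enc_bool xs)" a]
        trie_of_time_le[of enc_bool xs] a by (simp add: delim_code_def)
  qed
  then show ?thesis by (simp add: full_text_def)
qed

text \<open>The summand 23 is the cost of a conjunction gate. With it the induction closes although
  a conjunction adds no symbol to the pattern; a disjunction is paid for by its two copies of
  \<open>any_toks\<close>.\<close>

lemma pat_time_le: "pat_time (enc_nnf g) c t + 23 \<le> 60 * rexp_length (pat b g)"
proof (induction g)
  case (Lit s v)
  have tok: "length (name v) + 4 \<le> rexp_length (pat b (Lit s v))"
    using length_tok_code(1)[of "pat_val b s v # name v"]
    by (simp add: rexp_length_tok_rexp del: tok_rexp.simps)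
  have "pat_time (enc_nnf (Lit s v)) c t + 23 \<le> 60 * length (name v) + 240"
  proof (cases v)
    case (X i)
    then show ?thesis using tok_time_le[of "tNot (enc_bool s)" v] by (cases s) simp_all
  next
    case (Y i)
    then show ?thesis
      using look_time_le[of t i] tok_time_le[of tT v] tok_time_le[of Leaf v]
      by (cases s) (simp_all split: tree.split)
  qed
  with tok show ?case by linarith
next
  case (Gate q f g)
  have "size (enc_rexp any_toks) \<le> 100"
    by (simp add: any_toks_def any_bit_def tok_end_def)
  with Gate show ?case by (simp add: rexp_length_any_toks)
qed

lemma rexp_length_pat_ge: "(\<Sum>v\<leftarrow>nnf_leaves g. length (name v)) \<le> rexp_length (pat b g)"
proof (induction g)
  case (Lit s v)
  then show ?case
    using length_tok_code(1)[of "pat_val b s v # name v"]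
    by (simp add: rexp_length_tok_rexp del: tok_rexp.simps)
qed simp

lemma pats_time_le:
  assumes "Bs \<noteq> []"
    and "\<And>b. b \<in> set Bs \<Longrightarrow>
      b \<noteq> [] \<and> (\<Sum>i<length b. nat_len i) \<le> (\<Sum>v\<leftarrow>nnf_leaves g. length (name v))"
  shows "pats_time (enc_list (enc_list enc_bool) Bs) (enc_nnf g) \<le> 110 * rexp_length (pats Bs g)"
  using assms
proof (induction Bs)
  case Nil
  then show ?case by simp
next
  case (Cons b Bs)
  then obtain x xs where b: "b = x # xs" by (cases b) auto
  have "(\<Sum>i<Suc (length xs). nat_len i) \<le> rexp_length (pat b g)"
    using Cons.prems(2)[of b] rexp_length_pat_ge[of g b] b by simp
  then have 1: "pat_time (enc_nnf g) (enc_bool x) (trie_of (enc_list enc_bool xs)) +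
      trie_of_time (enc_list enc_bool xs) + 25 \<le> 110 * rexp_length (pat b g)"
    using pat_time_le[of g "enc_bool x" "trie_of (enc_list enc_bool xs)" b]
      trie_of_time_le[of enc_bool xs] rexp_length_pos[of "pat b g"] by linarith
  show ?case
  proof (cases Bs)
    case Nil
    then show ?thesis using 1 b by simp
  next
    case (Cons b' Bs')
    then have "pats_time (enc_list (enc_list enc_bool) Bs) (enc_nnf g) \<le>
        110 * rexp_length (pats Bs g)"
      using Cons.IH Cons.prems by simp
    then show ?thesis using 1 b Cons by simp
  qed
qed

text \<open>The size of the input tree is the right measure, as it also counts the
  negations.\<close>

lemma nnf_time_le: "nnf_time f s \<le> 25 * size f + 3"
  by (induction f s rule: nnf_time.induct) (auto split: tree.split)

lemma leaf_list_time_le: "leaf_list_time f acc \<le> 13 * size f + 3"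
  by (induction f acc rule: leaf_list_time.induct) auto

section \<open>Size of the output\<close>

lemma length_full_text_le:
  assumes "\<And>v x. v \<in> set vs \<Longrightarrow> real (length (tok_code (x # name v))) \<le> M"
  shows "real (length (full_text vs As)) \<le> 5 + real (length As) * (real (length vs) * M + 4)"
proof -
  have "real (length (toks_code (text_toks a vs))) \<le> real (length vs) * M" for a
    using assms
  proof (induction vs)
    case (Cons v vs)
    then have "real (length (toks_code (text_toks a vs))) \<le> real (length vs) * M" by simp
    then show ?case using Cons.prems[of v "text_val a v"]
      by (simp add: text_toks_def algebra_simps)
  qed (simp add: text_toks_def)
  note tok = this
  have "real (length (concat (map (\<lambda>a. toks_code (text_toks a vs) @ delim_code) As))) \<le>
      real (length As) * (real (length vs) * M + 4)"
  proof (induction As)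
    case (Cons a As)
    then show ?case using tok[of a] by (simp add: delim_code_def algebra_simps)
  qed simp
  then show ?thesis by (simp add: full_text_def delim_code_def)
qed

text \<open>A gate adds at most 33 symbols, namely two \<open>any_toks\<close> of length 15 and 3
  for the union. There is one gate fewer than leaves, so 33 can be charged to each leaf.\<close>

lemma rexp_length_pattern_le:
  assumes "\<And>v x. v \<in> set (nnf_leaves g) \<Longrightarrow> real (length (tok_code (x # name v))) \<le> M"
    and "Bs \<noteq> []"
  shows "real (rexp_length (pattern g Bs)) \<le>
    9 + real (length Bs) * (real (length (nnf_leaves g)) * (M + 33) + 3)"
proof -
  have "real (rexp_length (pat b g)) + 33 \<le> real (length (nnf_leaves g)) * (M + 33)" for b
    using assms(1)
  proof (induction g)
    case (Lit s v)
    then show ?case by (simp add: rexp_length_tok_rexp del: tok_rexp.simps)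
  next
    case (Gate q f g)
    then have "real (rexp_length (pat b f)) + 33 \<le> real (length (nnf_leaves f)) * (M + 33)"
      "real (rexp_length (pat b g)) + 33 \<le> real (length (nnf_leaves g)) * (M + 33)" by auto
    then show ?case by (simp add: rexp_length_any_toks algebra_simps)
  qed
  note pat = this
  have "real (rexp_length (pats Bs g)) \<le>
      real (length Bs) * (real (length (nnf_leaves g)) * (M + 33) + 3)"
    using assms(2)
  proof (induction Bs)
    case (Cons b Bs)
    then show ?case using pat[of b] by (cases Bs) (simp_all add: algebra_simps)
  qed simp
  then show ?thesis by (simp add: pattern_def delim_def)
qed

lemma instance_leaves:
  assumes "each_variable_once m F"
  shows "length (leaves F) = 2 * m"
    and "(\<Sum>i<m. nat_len i) \<le> (\<Sum>v\<leftarrow>leaves F. length (name v))"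
proof -
  have d: "distinct (leaves F)" and s: "set (leaves F) = X ` {..<m} \<union> Y ` {..<m}"
    using assms by (auto simp: each_variable_once_def)
  have disj: "X ` {..<m} \<inter> Y ` {..<m} = {}" by auto
  have inj: "inj_on X {..<m}" "inj_on Y {..<m}" by (auto simp: inj_on_def)
  have "length (leaves F) = card (set (leaves F))" using d by (simp add: distinct_card)
  also have "\<dots> = 2 * m" unfolding s using disj inj by (simp add: card_Un_disjoint card_image)
  finally show "length (leaves F) = 2 * m" .
  have "(\<Sum>i<m. nat_len i) \<le> (\<Sum>i<m. length (name (X i)))" by (intro sum_mono) simp
  also have "\<dots> = (\<Sum>v\<in>X ` {..<m}. length (name v))" using inj by (simp add: sum.reindex)
  also have "\<dots> \<le> (\<Sum>v\<in>set (leaves F). length (name v))" unfolding s by (intro sum_mono2) auto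
  also have "\<dots> = (\<Sum>v\<leftarrow>leaves F. length (name v))" using d by (simp add: sum_list_distinct_conv_sum_set)
  finally show "(\<Sum>i<m. nat_len i) \<le> (\<Sum>v\<leftarrow>leaves F. length (name v))" .
qed

text \<open>The value bit, the kind bit and the bits of the index, at most two symbols each, and the
  end marker give at most \<open>2 * nat_len i + 7\<close>. Since \<open>2 * m \<ge> 2\<close>, the
  logarithm is at least 1 and absorbs the 7.\<close>

lemma length_tok_code_name_le:
  assumes "v \<in> X ` {..<m} \<union> Y ` {..<m}"
  shows "real (length (tok_code (x # name v))) \<le> 9 * log 2 (real (2 * m))"
proof -
  from assms obtain i where i: "i < m" "v = X i \<or> v = Y i" by auto
  have L: "log 2 (real (2 * m)) \<ge> 1" using i by (simp add: log_mult)
  have "real (nat_len i) \<le> log 2 (real (2 * m))"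
  proof (cases "i = 0")
    case True
    then show ?thesis using L by simp
  next
    case False
    then have "2 ^ nat_len i \<le> 2 * m" using two_power_nat_len[of i] i by linarith
    then have "(2::real) ^ nat_len i \<le> real (2 * m)"
      by (metis of_nat_le_iff of_nat_numeral of_nat_power)
    then show ?thesis using i by (subst le_log_iff) (auto simp: powr_realpow)
  qed
  moreover have "length (name v) = Suc (nat_len i)" using i by auto
  then have "real (length (tok_code (x # name v))) \<le> 2 * real (nat_len i) + 7"
    using length_tok_code(2)[of "x # name v"] by simp
  ultimately show ?thesis using L by linarith
qed

text \<open>Time is measured against input plus output, since the output may exceed the input by a
  logarithmic factor.\<close>

theorem theoremE1:
  "\<exists>(P :: program) (C :: real). C > 0 \<and>
     (\<forall>(m :: nat) (n :: nat) (s :: nat) (F :: formula) (A :: bool list list) (B :: bool list list).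
        formula_pair_instance m n F A B \<and> formula_size F = s \<and> n \<ge> 1 \<longrightarrow>
        (\<exists>(t :: bool list) (p :: bool rexp) (time :: nat).
           computes_in_time P (enc_instance F A B) (enc_output t p) time \<and>
           real time \<le> C * real (size (enc_instance F A B) + length t + rexp_length p) \<and>
           real (length t) \<le> C * (real n * real s * log 2 (real s)) \<and>
           real (rexp_length p) \<le> C * (real n * real s * log 2 (real s)) \<and>
           (matches_substring p t \<longleftrightarrow> (\<exists>a \<in> set A. \<exists>b \<in> set B. holds F a b))))"
proof (intro exI[of _ prog] exI[of _ "1000 :: real"] conjI allI impI)
  fix m n s :: nat and F :: formula and A B :: "bool list list"
  assume asm: "formula_pair_instance m n F A B \<and> formula_size F = s \<and> n \<ge> 1"
  let ?g = "nnf_of F False" and ?t = "full_text (leaves F) A" and ?L = "log 2 (real s)"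
  let ?p = "pattern ?g B" and ?inp = "enc_instance F A B"
  from asm have once: "each_variable_once m F" and n: "n \<ge> 1"
    and lA: "length A = n" "\<And>a. a \<in> set A \<Longrightarrow> length a = m"
    and lB: "length B = n" "\<And>b. b \<in> set B \<Longrightarrow> length b = m"
    by (auto simp: formula_pair_instance_def enumerates_vectors_def)
  have s: "length (leaves F) = s" "s = 2 * m"
    using asm instance_leaves(1)[OF once] by (auto simp: formula_size_def)
  have "m > 0" using s leaves_nonempty[of F] by (cases m) auto
  have B: "B \<noteq> []" using lB n by auto
  have w: "(\<Sum>i<m. nat_len i) \<le> (\<Sum>v\<leftarrow>leaves F. length (name v))"
    by (rule instance_leaves(2)[OF once])
  define time where "time = nnf_time (enc_formula F) Leaf + leaf_list_time (enc_formula F) Leaf +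
    texts_time (enc_list (enc_list enc_bool) A) (leaf_list (enc_formula F) Leaf) +
    pats_time (enc_list (enc_list enc_bool) B) (nnf_tree (enc_formula F) Leaf) +
    4 * size (enc_rexp delim) + 59"
  have "computes_in_time prog ?inp (enc_output ?t ?p) time"
    using output_tree_enc[of m n F A B] asm
    by (simp add: computes_in_time_def prog_nth enc_instance_def run_main time_def) (simp add: prog_def)
  moreover have "real time \<le> 1000 * real (size ?inp + length ?t + rexp_length ?p)"
  proof -
    have "texts_time (enc_list (enc_list enc_bool) A) (leaf_list (enc_formula F) Leaf) \<le> 50 * length ?t"
      using texts_time_le[of A "leaves F"] leaf_list_enc[of F "[]"] lA w \<open>m > 0\<close> by fastforce
    moreover have "pats_time (enc_list (enc_list enc_bool) B) (nnf_tree (enc_formula F) Leaf) \<le>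
        110 * rexp_length (pats B ?g)"
      using pats_time_le[OF B, of ?g] nnf_tree_enc[of F False] lB w \<open>m > 0\<close> by fastforce
    moreover have "4 * size (enc_rexp delim) \<le> 200" by (simp add: delim_def)
    moreover have "rexp_length (pats B ?g) + 9 = rexp_length ?p"
      by (simp add: pattern_def delim_def)
    moreover have "size (enc_formula F) \<le> size ?inp" by (simp add: enc_instance_def)
    \<comment> \<open>The arithmetic is done on plain variables. The constant overheads are absorbed
      by the 9 symbols that surround \<open>pats B ?g\<close> in the pattern.\<close>
    moreover have "c1 + c2 + c3 + c4 + c5 + 59 \<le> 1000 * (i + t + p)"
      if "c3 \<le> 50 * t" "c4 \<le> 110 * q" "c5 \<le> 200" "q + 9 = p" "z \<le> i"
        "c1 \<le> 25 * z + 3" "c2 \<le> 13 * z + 3"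
      for c1 c2 c3 c4 c5 t q p z i :: nat
      using that by (simp add: algebra_simps)
    ultimately have "time \<le> 1000 * (size ?inp + length ?t + rexp_length ?p)"
      using nnf_time_le[of "enc_formula F" Leaf] leaf_list_time_le[of "enc_formula F" Leaf]
      unfolding time_def by blast
    then show ?thesis by (metis of_nat_le_iff of_nat_mult of_nat_numeral)
  qed
  moreover have tok: "real (length (tok_code (x # name v))) \<le> 9 * ?L" if "v \<in> set (leaves F)" for v x
    using length_tok_code_name_le[of v m x] that once s by (simp add: each_variable_once_def)
  have L: "?L \<ge> 1" using s \<open>m > 0\<close> by (simp add: log_mult)
  \<comment> \<open>These are the lower-order terms in both size bounds; \<open>?L \<ge> 1\<close>
    lets the leading term dominate them.\<close>
  have bound: "1 \<le> real n * real s * ?L" "real n \<le> real n * real s * ?L"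
    "real n * real s \<le> real n * real s * ?L"
  proof -
    have 1: "real n * real s \<le> real n * real s * ?L" 
      using mult_left_mono[OF L, of "real n * real s"] by simp
    have 2: "real n \<le> real n * real s"
      using mult_left_mono[of 1 "real s" "real n"] s \<open>m > 0\<close> by simp
    show "real n * real s \<le> real n * real s * ?L" by (rule 1)
    show "real n \<le> real n * real s * ?L" using 1 2 by linarith
    show "1 \<le> real n * real s * ?L" using 1 2 n by linarith
  qed
  have "real (length ?t) \<le> 5 + real n * (real s * (9 * ?L) + 4)"
    using length_full_text_le[of "leaves F" "9 * ?L" A] tok s lA by simp
  then have "real (length ?t) \<le> 1000 * (real n * real s * ?L)"
    using bound by (simp add: algebra_simps)
  moreover have "real (rexp_length ?p) \<le> 9 + real n * (real s * (9 * ?L + 33) + 3)"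
    using rexp_length_pattern_le[of ?g "9 * ?L" B] tok s lB B by simp
  then have "real (rexp_length ?p) \<le> 1000 * (real n * real s * ?L)"
    using bound by (simp add: algebra_simps)
  moreover have "matches_substring ?p ?t \<longleftrightarrow> (\<exists>a \<in> set A. \<exists>b \<in> set B. holds F a b)"
    using matches_pattern_iff[OF B, of ?g A] by (simp add: nnf_holds_of)
  ultimately show "\<exists>t p time.
      computes_in_time prog ?inp (enc_output t p) time \<and>
      real time \<le> 1000 * real (size ?inp + length t + rexp_length p) \<and>
      real (length t) \<le> 1000 * (real n * real s * log 2 (real s)) \<and>
      real (rexp_length p) \<le> 1000 * (real n * real s * log 2 (real s)) \<and>
      (matches_substring p t \<longleftrightarrow> (\<exists>a \<in> set A. \<exists>b \<in> set B. holds F a b))"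
    by blast
qed simp

end
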